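(* (1) For each $n\in\mathbb{N}$ there exists an $n$-dimensional closed set-aposyndetic continuum that is not $(n+1)$-dimensional closed set-aposyndetic. (2) There exists a countable closed set-aposyndetic continuum that is not $0$-dimensional closed set-aposyndetic. (3) For each $n\in\mathbb{N}$ there exists an $n$-aposyndetic continuum that is not $(n+1)$-aposyndetic.
   Context: All spaces are metrizable. A continuum is a connected compact metric space; $\mathbb{N}=\{1,2,3,\dots\}$. For a continuum $X$ and a class $\mathcal{F}$ of closed sets, consider the condition: $( * )$ for each $x\in X$ and each closed subset $A$ of $X$ with $A\in\mathcal{F}$ and $A\subseteq X\setminus\{x\}$, there exists a subcontinuum $T$ of $X$ such that $x\in\mathrm{Int}_X T\subseteq T\subseteq X\setminus A$. For an integer $n\ge 0$, $X$ is $n$-dimensional closed set-aposyndetic if $( * )$ holds with $\mathcal{F}$ the class of $n$-dimensional closed sets. $X$ is countable closed set-aposyndetic if $( * )$ holds with $\mathcal{F}$ the class of countable closed sets. For $n\ge 1$, $X$ is $n$-aposyndetic if $( * )$ holds with $\mathcal{F}$ the class of $n$-point sets. *)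

theory Defs
  imports "HOL-Analysis.Analysis"
begin

definition continuum :: "'a topology \<Rightarrow> bool" where
  "continuum X \<longleftrightarrow> metrizable_space X \<and> compact_space X \<and> connected_space X"

definition subcontinuum_of :: "'a set \<Rightarrow> 'a topology \<Rightarrow> bool" where
  "subcontinuum_of T X \<longleftrightarrow> T \<subseteq> topspace X \<and> continuum (subtopology X T)"

text \<open>Topological dimension is the library's small inductive dimension; on separable metrizable
  spaces (in particular on closed subsets of continua) it agrees with the large inductive and
  the covering dimension. The dimension of the empty space is \<open>-1\<close>, so a 0-dimensional space is
  nonempty.\<close>

definition has_dimension :: "'a topology \<Rightarrow> nat \<Rightarrow> bool" where
  "has_dimension X n \<longleftrightarrow> X dim_le int n \<and> \<not> X dim_le (int n - 1)"

definition closed_set_aposyndetic :: "'a topology \<Rightarrow> 'a set set \<Rightarrow> bool" where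
  "closed_set_aposyndetic X \<F> \<longleftrightarrow>
     (\<forall>x \<in> topspace X. \<forall>A. closedin X A \<and> A \<in> \<F> \<and> A \<subseteq> topspace X - {x} \<longrightarrow>
        (\<exists>T. subcontinuum_of T X \<and> x \<in> X interior_of T \<and> T \<subseteq> topspace X - A))"

definition dimensional_closed_set_aposyndetic :: "nat \<Rightarrow> 'a topology \<Rightarrow> bool" where
  "dimensional_closed_set_aposyndetic n X \<longleftrightarrow>
     closed_set_aposyndetic X {A. has_dimension (subtopology X A) n}"

definition countable_closed_set_aposyndetic :: "'a topology \<Rightarrow> bool" where
  "countable_closed_set_aposyndetic X \<longleftrightarrow> closed_set_aposyndetic X {A. countable A}"

definition n_aposyndetic :: "nat \<Rightarrow> 'a topology \<Rightarrow> bool" where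
  "n_aposyndetic n X \<longleftrightarrow> closed_set_aposyndetic X {A. finite A \<and> card A = n}"

text \<open>Every compact metrizable space embeds in the Hilbert cube. Hence every continuum is
  homeomorphic to a topology whose points have type \<^typ>\<open>nat \<Rightarrow> real\<close>, and existence of a continuum
  with a topological property can be stated over this type without loss of generality. The
  topology (and its point set) is arbitrary; it need not be the product topology.\<close>

type_synonym hilbert_point = "nat \<Rightarrow> real"

end

theory Submission
  imports Defs "HOL-Homology.Brouwer_Degree"
begin

text \<open>Take a compact, locally connected \<open>Y\<close> and a closed \<open>B \<subset> Y\<close>, and glue a sequence of copies of
  \<open>Y\<close> and its limit copy \<open>Y\<^sub>0\<close> along \<open>B\<close>. A connected set that misses \<open>B\<close> lies in one
  copy, so a point of \<open>Y\<^sub>0 - B\<close> has no continuum neighbourhood missing \<open>B\<close>. On the other hand, if a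
  closed \<open>A\<close> cannot cut \<open>x \<in> Y\<^sub>0\<close> off from \<open>B\<close> inside \<open>Y\<^sub>0\<close>, then a continuum in \<open>Y\<^sub>0 - A\<close> from
  a neighbourhood of \<open>x\<close> to \<open>B\<close> has parallel copies in all late copies of \<open>Y\<close>, and together
  they form a continuum neighbourhood of \<open>x\<close> missing \<open>A\<close>. For (1), \<open>Y\<close> is the \<open>(n + 2)\<close>-cube and \<open>B\<close>
  its boundary: by Brouwer's theorem, an at most \<open>n\<close>-dimensional closed set cannot
  cut a point off from the boundary. For (2) and (3), \<open>Y\<close> is the Hilbert cube, which no countable
  set separates, and \<open>B\<close> is a Cantor set and a set of \<open>n + 1\<close> points, respectively.\<close>

text \<open>Small inductive dimension speaks of frontiers of small neighbourhoods, Brouwer's theorem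
  of maps; the bridge is the extension of tuples of real functions without common zero. With tuples
  instead of maps into a sphere, Tietze's theorem extends the coordinates separately, and only the
  last one has to be kept nonzero, on the common zeros of the others. The gap in (1) also comes from
  here: on the \<open>(n + 2)\<close>-cube the map \<open>x \<mapsto> x - p\<close> has
  \<open>n + 2\<close> coordinates, one more than the \<open>n + 1\<close> for which an at most
  \<open>n\<close>-dimensional compact set has the extension property, and the surplus coordinate
  lets the tuple extend over the whole space. In (2) and (3) a set in the given class could block
  the limit copy only by swallowing all of \<open>B\<close>: the Cantor set is uncountable yet
  zero-dimensional, and \<open>n\<close> points cannot cover \<open>n + 1\<close>.\<close>

section \<open>Extension of nowhere vanishing maps and dimension\<close>

text \<open>For compact \<open>A\<close>, maps from closed subsets of \<open>A\<close> to the \<open>(k - 1)\<close>-sphere extend to \<open>A\<close>;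
  equivalently, \<open>A\<close> has dimension at most \<open>k - 1\<close>.\<close>

definition nonvanishing_extension ::
    "'a::topological_space set \<Rightarrow> nat \<Rightarrow> bool" where
  "nonvanishing_extension A k \<longleftrightarrow>
     (\<forall>C (f :: nat \<Rightarrow> 'a \<Rightarrow> real).
        closed C \<and> C \<subseteq> A \<and> (\<forall>i<k. continuous_on C (f i)) \<and> (\<forall>x\<in>C. \<exists>i<k. f i x \<noteq> 0) \<longrightarrow>
        (\<exists>g. (\<forall>i<k. continuous_on A (g i) \<and> (\<forall>x\<in>C. g i x = f i x)) \<and>
             (\<forall>x\<in>A. \<exists>i<k. g i x \<noteq> 0)))"

lemma nonvanishing_extensionD:
  fixes f :: "nat \<Rightarrow> 'a::topological_space \<Rightarrow> real"
  assumes "nonvanishing_extension A k" "closed C" "C \<subseteq> A"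
    "\<And>i. i < k \<Longrightarrow> continuous_on C (f i)" "\<And>x. x \<in> C \<Longrightarrow> \<exists>i<k. f i x \<noteq> 0"
  obtains g where "\<And>i. i < k \<Longrightarrow> continuous_on A (g i)"
    "\<And>i x. i < k \<Longrightarrow> x \<in> C \<Longrightarrow> g i x = f i x" "\<And>x. x \<in> A \<Longrightarrow> \<exists>i<k. g i x \<noteq> 0"
proof -
  have "\<exists>g. (\<forall>i<k. continuous_on A (g i) \<and> (\<forall>x\<in>C. g i x = f i x)) \<and>
             (\<forall>x\<in>A. \<exists>i<k. g i x \<noteq> 0)"
    using assms unfolding nonvanishing_extension_def by blast
  then show ?thesis using that by blast
qed

section \<open>Tietze extension with sign conditions, and gluing\<close>

lemma Tietze_real:
  fixes f :: "'a::{metric_space,second_countable_topology} \<Rightarrow> real"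
  assumes "closed C" "continuous_on C f"
  obtains g where "continuous_on UNIV g" "\<And>x. x \<in> C \<Longrightarrow> g x = f x"
  using Tietze_unbounded[of C f UNIV] assms by auto

lemma Tietze_real_family:
  fixes f :: "nat \<Rightarrow> 'a::{metric_space,second_countable_topology} \<Rightarrow> real"
  assumes "closed C" "\<And>i. i < k \<Longrightarrow> continuous_on C (f i)"
  obtains g where "\<And>i. i < k \<Longrightarrow> continuous_on UNIV (g i)" "\<And>i x. i < k \<Longrightarrow> x \<in> C \<Longrightarrow> g i x = f i x"
proof -
  have "\<exists>g. continuous_on UNIV g \<and> (\<forall>x\<in>C. g x = f i x)" if "i < k" for i
    by (rule Tietze_real[of C "f i"]) (use assms that in auto)
  then have "\<exists>g. \<forall>i<k. continuous_on UNIV (g i) \<and> (\<forall>x\<in>C. g i x = f i x)" by metis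
  then show ?thesis using that by blast
qed

lemma glue_closed:
  fixes f g :: "nat \<Rightarrow> 'a::topological_space \<Rightarrow> real"
  assumes "closed S" "closed T" "\<And>i. i < k \<Longrightarrow> continuous_on S (f i)"
    "\<And>i. i < k \<Longrightarrow> continuous_on T (g i)" "\<And>i x. i < k \<Longrightarrow> x \<in> S \<Longrightarrow> x \<in> T \<Longrightarrow> f i x = g i x"
  obtains h where "\<And>i. i < k \<Longrightarrow> continuous_on (S \<union> T) (h i)"
    "\<And>i x. i < k \<Longrightarrow> x \<in> S \<Longrightarrow> h i x = f i x" "\<And>i x. i < k \<Longrightarrow> x \<in> T \<Longrightarrow> h i x = g i x"
proof -
  define h where "h = (\<lambda>i x. if x \<in> S then f i x else g i x)"
  show thesis
  proof
    show "continuous_on (S \<union> T) (h i)" if "i < k" for i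
      unfolding h_def using that assms
      by (intro continuous_on_cases) auto
  qed (use assms in \<open>auto simp: h_def\<close>)
qed

text \<open>The logarithm turns positivity into no condition at all.\<close>

lemma Tietze_positive:
  fixes f :: "'a::{metric_space,second_countable_topology} \<Rightarrow> real"
  assumes "closed C" "continuous_on C f" "\<And>x. x \<in> C \<Longrightarrow> f x > 0"
  obtains g where "continuous_on UNIV g" "\<And>x. x \<in> C \<Longrightarrow> g x = f x" "\<And>x. g x > 0"
proof -
  have "continuous_on C (\<lambda>x. ln (f x))"
    using assms by (intro continuous_intros) force+
  then obtain h where "continuous_on UNIV h" "\<And>x. x \<in> C \<Longrightarrow> h x = ln (f x)"
    using Tietze_real assms(1) by blast
  then show ?thesis
    using assms by (intro that[of "\<lambda>x. exp (h x)"]) (auto intro!: continuous_intros)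
qed

text \<open>Supplies the last coordinate of a tuple. On \<open>P\<close> and \<open>N\<close>
  separately the sign is constant, so a positive and a negative extension can be glued to
  \<open>f\<close>, although \<open>f\<close> may change sign on the rest of
  \<open>C\<close>.\<close>

lemma Tietze_signed:
  fixes f :: "'a::{metric_space,second_countable_topology} \<Rightarrow> real"
  assumes "closed C" "closed P" "closed N" "P \<inter> N = {}" "continuous_on C f"
    and pos: "\<And>x. x \<in> C \<inter> P \<Longrightarrow> f x > 0" and neg: "\<And>x. x \<in> C \<inter> N \<Longrightarrow> f x < 0"
  obtains g where "continuous_on UNIV g" "\<And>x. x \<in> C \<Longrightarrow> g x = f x" "\<And>x. x \<in> P \<union> N \<Longrightarrow> g x \<noteq> 0"
proof -
  obtain p where p: "continuous_on UNIV p" "\<And>x. x \<in> C \<inter> P \<Longrightarrow> p x = f x" "\<And>x. p x > (0::real)"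
    using Tietze_positive[of "C \<inter> P" f] assms
    by (metis IntD1 closed_Int continuous_on_subset subsetI)
  have "continuous_on (C \<inter> N) (\<lambda>x. - f x)"
    using assms(5) by (intro continuous_intros) (auto intro: continuous_on_subset)
  then obtain n where n: "continuous_on UNIV n" "\<And>x. x \<in> C \<inter> N \<Longrightarrow> n x = - f x" "\<And>x. n x > (0::real)"
    using Tietze_positive[of "C \<inter> N" "\<lambda>x. - f x"] assms by (metis closed_Int neg_0_less_iff_less)
  define h where "h = (\<lambda>x. if x \<in> C then f x else if x \<in> P then p x else - n x)"
  have PN: "continuous_on (P \<union> N) (\<lambda>x. if x \<in> P then p x else - n x)"
    using assms p n by (intro continuous_on_cases) (auto intro!: continuous_intros intro: continuous_on_subset)
  have "continuous_on (C \<union> (P \<union> N)) h"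
    unfolding h_def using assms(1-5) p(2) n(2) by (intro continuous_on_cases PN) auto
  then obtain g where g: "continuous_on UNIV g" "\<And>x. x \<in> C \<union> (P \<union> N) \<Longrightarrow> g x = h x"
    by (rule Tietze_real[of "C \<union> (P \<union> N)" h, rotated]) (use assms in auto)
  show ?thesis
  proof
    show "g x \<noteq> 0" if "x \<in> P \<union> N" for x
      using that g(2)[of x] p(3)[of x] n(3)[of x] pos[of x] neg[of x] assms(4)
      by (auto simp: h_def split: if_splits)
  qed (use g in \<open>auto simp: h_def\<close>)
qed

section \<open>Permanence of the extension property\<close>

lemma nonvanishing_extension_0: "nonvanishing_extension A 0 \<longleftrightarrow> A = {}"
  by (auto simp: nonvanishing_extension_def)

lemma nonvanishing_extension_subset:
  fixes A :: "'a::{metric_space,second_countable_topology} set"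
  assumes "nonvanishing_extension A k" "B \<subseteq> A"
  shows "nonvanishing_extension B k"
  unfolding nonvanishing_extension_def
proof (intro allI impI, elim conjE)
  fix C and f :: "nat \<Rightarrow> 'a \<Rightarrow> real"
  assume C: "closed C" "C \<subseteq> B" "\<forall>i<k. continuous_on C (f i)" "\<forall>x\<in>C. \<exists>i<k. f i x \<noteq> 0"
  obtain g where "\<And>i. i < k \<Longrightarrow> continuous_on A (g i)"
    "\<And>i x. i < k \<Longrightarrow> x \<in> C \<Longrightarrow> g i x = f i x" "\<And>x. x \<in> A \<Longrightarrow> \<exists>i<k. g i x \<noteq> 0"
    by (rule nonvanishing_extensionD[OF assms(1), of C f]) (use C assms(2) in auto)
  then show "\<exists>g. (\<forall>i<k. continuous_on B (g i) \<and> (\<forall>x\<in>C. g i x = f i x)) \<and>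
             (\<forall>x\<in>B. \<exists>i<k. g i x \<noteq> 0)"
    using assms(2) by (intro exI[of _ g]) (auto intro: continuous_on_subset)
qed

text \<open>The two extensions are made one after the other: over \<open>B\<close> the values are
  prescribed on \<open>(C \<union> A) \<inter> B\<close>, so that they match the extension over
  \<open>A\<close> on the overlap.\<close>

lemma nonvanishing_extension_Un:
  fixes A B :: "'a::{metric_space,second_countable_topology} set"
  assumes "nonvanishing_extension A k" "nonvanishing_extension B k" "closed A" "closed B"
  shows "nonvanishing_extension (A \<union> B) k"
  unfolding nonvanishing_extension_def
proof (intro allI impI, elim conjE)
  fix C and f :: "nat \<Rightarrow> 'a \<Rightarrow> real"
  assume C: "closed C" "C \<subseteq> A \<union> B" "\<forall>i<k. continuous_on C (f i)" "\<forall>x\<in>C. \<exists>i<k. f i x \<noteq> 0"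
  obtain g where g: "\<And>i. i < k \<Longrightarrow> continuous_on A (g i)"
    "\<And>i x. i < k \<Longrightarrow> x \<in> C \<inter> A \<Longrightarrow> g i x = f i x" "\<And>x. x \<in> A \<Longrightarrow> \<exists>i<k. g i x \<noteq> 0"
    by (rule nonvanishing_extensionD[OF assms(1), of "C \<inter> A" f])
      (use C assms(3) in \<open>auto intro: continuous_on_subset\<close>)
  obtain h where h: "\<And>i. i < k \<Longrightarrow> continuous_on (C \<union> A) (h i)"
    "\<And>i x. i < k \<Longrightarrow> x \<in> C \<Longrightarrow> h i x = f i x" "\<And>i x. i < k \<Longrightarrow> x \<in> A \<Longrightarrow> h i x = g i x"
    by (rule glue_closed[of C A k f g]) (use C g assms in auto)
  have hnz: "\<exists>i<k. h i x \<noteq> 0" if "x \<in> C \<union> A" for x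
    using that h(2,3) g(3) C(4) by (metis Un_iff)
  obtain g' where g': "\<And>i. i < k \<Longrightarrow> continuous_on B (g' i)"
    "\<And>i x. i < k \<Longrightarrow> x \<in> (C \<union> A) \<inter> B \<Longrightarrow> g' i x = h i x" "\<And>x. x \<in> B \<Longrightarrow> \<exists>i<k. g' i x \<noteq> 0"
    by (rule nonvanishing_extensionD[OF assms(2), of "(C \<union> A) \<inter> B" h])
      (use C assms(3,4) hnz in \<open>auto intro: continuous_on_subset[OF h(1)]\<close>)
  obtain h' where h': "\<And>i. i < k \<Longrightarrow> continuous_on ((C \<union> A) \<union> B) (h' i)"
    "\<And>i x. i < k \<Longrightarrow> x \<in> C \<union> A \<Longrightarrow> h' i x = h i x" "\<And>i x. i < k \<Longrightarrow> x \<in> B \<Longrightarrow> h' i x = g' i x"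
    by (rule glue_closed[of "C \<union> A" B k h g']) (use C h(1) g'(1,2) assms in auto)
  show "\<exists>g. (\<forall>i<k. continuous_on (A \<union> B) (g i) \<and> (\<forall>x\<in>C. g i x = f i x)) \<and>
             (\<forall>x\<in>A \<union> B. \<exists>i<k. g i x \<noteq> 0)"
  proof (intro exI[of _ h'] conjI allI impI ballI)
    show "continuous_on (A \<union> B) (h' i)" if "i < k" for i
      using h'(1)[OF that] by (rule continuous_on_subset) auto
    show "h' i x = f i x" if "i < k" "x \<in> C" for i x
      using that h'(2) h(2) by simp
    show "\<exists>i<k. h' i x \<noteq> 0" if "x \<in> A \<union> B" for x
      using that hnz g'(3) h'(2,3) by (metis Un_iff)
  qed
qed

lemma nonvanishing_extension_Union:
  fixes \<A> :: "'a::{metric_space,second_countable_topology} set set"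
  assumes "finite \<A>" "\<And>A. A \<in> \<A> \<Longrightarrow> closed A \<and> nonvanishing_extension A k"
  shows "nonvanishing_extension (\<Union>\<A>) k"
  using assms
proof (induction \<A>)
  case empty
  then show ?case by (auto simp: nonvanishing_extension_def)
next
  case (insert A \<A>)
  then have "closed (\<Union>\<A>)" by blast
  with insert show ?case by (simp add: nonvanishing_extension_Un)
qed

text \<open>The last coordinate only has to be nonzero on the common zero set of the other ones, so the
  separator lets its sign be chosen independently on the two sides.\<close>

lemma nonvanishing_extension_Suc:
  fixes A :: "'a::{metric_space,second_countable_topology} set"
  assumes "closed A"
    and sep: "\<And>D E. \<lbrakk>closed D; closed E; D \<subseteq> A; E \<subseteq> A; D \<inter> E = {}\<rbrakk> \<Longrightarrow>
      \<exists>U V. openin (top_of_set A) U \<and> openin (top_of_set A) V \<and> U \<inter> V = {} \<and> D \<subseteq> U \<and> E \<subseteq> V \<and>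
        nonvanishing_extension (A - U - V) k"
  shows "nonvanishing_extension A (Suc k)"
  unfolding nonvanishing_extension_def
proof (intro allI impI, elim conjE)
  fix C and f :: "nat \<Rightarrow> 'a \<Rightarrow> real"
  assume C: "closed C" "C \<subseteq> A" "\<forall>i<Suc k. continuous_on C (f i)" "\<forall>x\<in>C. \<exists>i<Suc k. f i x \<noteq> 0"
  \<comment> \<open>The zeros in \<open>C\<close> of the first \<open>k\<close> coordinates, split
    by the sign of the last one; a common point of \<open>D\<close> and \<open>E\<close> would be a
    zero of the whole tuple.\<close>
  define D where "D = (\<Inter>i\<in>{..<k}. {x \<in> C. f i x = 0}) \<inter> {x \<in> C. f k x \<ge> 0}"
  define E where "E = (\<Inter>i\<in>{..<k}. {x \<in> C. f i x = 0}) \<inter> {x \<in> C. f k x \<le> 0}"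
  have "closed {x \<in> C. f i x = 0}" if "i < k" for i
    using continuous_closed_preimage_constant[of C "f i" 0] C that by auto
  moreover have "closed {x \<in> C. f k x \<ge> 0}" "closed {x \<in> C. f k x \<le> 0}"
    using continuous_closed_preimage[of C "f k" "{0..}"] continuous_closed_preimage[of C "f k" "{..0}"] C
    by (auto simp: vimage_def Int_def)
  ultimately have cl: "closed D" "closed E"
    unfolding D_def E_def by auto
  have "D \<inter> E = {}"
  proof (rule ccontr)
    assume "D \<inter> E \<noteq> {}"
    then obtain x where "x \<in> C" "\<forall>i<k. f i x = 0" "f k x = 0" by (fastforce simp: D_def E_def)
    then show False using C(4) less_Suc_eq by metis
  qed
  moreover have sub: "D \<subseteq> C" "E \<subseteq> C" by (auto simp: D_def E_def)
  ultimately obtain U V where UV: "openin (top_of_set A) U" "openin (top_of_set A) V" "U \<inter> V = {}"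
    "D \<subseteq> U" "E \<subseteq> V" and L: "nonvanishing_extension (A - U - V) k"
    using sep[of D E] cl C(2) by blast
  have clA: "closed (A - U)" "closed (A - V)"
    using UV(1,2) assms(1) by (auto simp: openin_open Diff_Int intro: closed_Diff)
  then have clL: "closed (A - U - V)"
    using closed_Int[of "A - U" "A - V"] by (simp add: Int_Diff Diff_Int2 set_diff_eq Int_def conj_ac)
  have nz: "\<exists>i<k. f i x \<noteq> 0" if "x \<in> C \<inter> (A - U - V)" for x
    using that UV(4,5) unfolding D_def E_def by fastforce
  obtain g where g: "\<And>i. i < k \<Longrightarrow> continuous_on (A - U - V) (g i)"
    "\<And>i x. i < k \<Longrightarrow> x \<in> C \<inter> (A - U - V) \<Longrightarrow> g i x = f i x" "\<And>x. x \<in> A - U - V \<Longrightarrow> \<exists>i<k. g i x \<noteq> 0"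
    by (rule nonvanishing_extensionD[OF L, of "C \<inter> (A - U - V)" f])
      (use C(1,3) clL nz in \<open>auto intro: continuous_on_subset simp: less_Suc_eq\<close>)
  obtain h where h: "\<And>i. i < k \<Longrightarrow> continuous_on (C \<union> (A - U - V)) (h i)"
    "\<And>i x. i < k \<Longrightarrow> x \<in> C \<Longrightarrow> h i x = f i x" "\<And>i x. i < k \<Longrightarrow> x \<in> A - U - V \<Longrightarrow> h i x = g i x"
    by (rule glue_closed[of C "A - U - V" k f g]) (use C(1,3) g(1,2) clL in auto)
  obtain H where H: "\<And>i. i < k \<Longrightarrow> continuous_on UNIV (H i)"
    "\<And>i x. i < k \<Longrightarrow> x \<in> C \<union> (A - U - V) \<Longrightarrow> H i x = h i x"
    using Tietze_real_family[of "C \<union> (A - U - V)" k h] C(1) clL h(1) by blast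
  \<comment> \<open>The common zeros of the extended first \<open>k\<close> coordinates avoid the
    separator, so inside \<open>A\<close> they lie in \<open>U\<close> or in \<open>V\<close>. The
    last coordinate gets a positive sign on the \<open>U\<close> side and a negative one on the
    \<open>V\<close> side; on \<open>C\<close> it already has these signs, since zeros of the first
    \<open>k\<close> coordinates there lie in \<open>D\<close> or \<open>E\<close>.\<close>
  define G where "G = (\<Inter>i\<in>{..<k}. {x. H i x = 0})"
  have "closed {x. H i x = 0}" if "i < k" for i
    using continuous_closed_preimage_constant[of UNIV "H i" 0] H(1)[OF that] by simp
  then have clG: "closed G" unfolding G_def by auto
  have GL: "G \<inter> (A - U - V) = {}"
    using H(2) h(3) g(3) by (fastforce simp: G_def)
  have GC: "f i x = 0" if "x \<in> G \<inter> C" "i < k" for i x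
    using that H(2)[of i x] h(2)[of i x] by (auto simp: G_def)
  have pos: "f k x > 0" if "x \<in> C \<inter> (G \<inter> (A - V))" for x
  proof -
    have "x \<notin> E" using that UV by auto
    then show ?thesis using that GC[of x] by (auto simp: E_def)
  qed
  have neg: "f k x < 0" if "x \<in> C \<inter> (G \<inter> (A - U))" for x
  proof -
    have "x \<notin> D" using that UV by auto
    then show ?thesis using that GC[of x] by (auto simp: D_def)
  qed
  obtain F where F: "continuous_on UNIV F" "\<And>x. x \<in> C \<Longrightarrow> F x = f k x"
    "\<And>x. x \<in> G \<inter> (A - V) \<union> G \<inter> (A - U) \<Longrightarrow> F x \<noteq> 0"
    by (rule Tietze_signed[of C "G \<inter> (A - V)" "G \<inter> (A - U)" "f k"])
      (use C(1,3) clG clA pos neg GL in auto)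
  show "\<exists>g. (\<forall>i<Suc k. continuous_on A (g i) \<and> (\<forall>x\<in>C. g i x = f i x)) \<and>
             (\<forall>x\<in>A. \<exists>i<Suc k. g i x \<noteq> 0)"
  proof (intro exI[of _ "H(k := F)"] conjI allI impI ballI)
    show "continuous_on A ((H(k := F)) i)" if "i < Suc k" for i
      using that H(1)[of i] F(1) by (auto intro: continuous_on_subset simp: less_Suc_eq)
    show "(H(k := F)) i x = f i x" if "i < Suc k" "x \<in> C" for i x
      using that H(2)[of i x] h(2)[of i x] F(2) by (auto simp: less_Suc_eq)
    show "\<exists>i<Suc k. (H(k := F)) i x \<noteq> 0" if "x \<in> A" for x
    proof (cases "x \<in> G")
      case True
      then have "F x \<noteq> 0" using that UV(3) by (intro F(3)) auto
      then show ?thesis by (intro exI[of _ k]) simp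
    next
      case False
      then obtain i where "i < k" "H i x \<noteq> 0" by (auto simp: G_def)
      then show ?thesis by (intro exI[of _ i]) auto
    qed
  qed
qed

text \<open>Passes from small neighbourhoods to separators: finitely many neighbourhoods with
  closures off \<open>E\<close> cover the compact \<open>D\<close>, and the boundary of their union
  lies in the union of their frontiers, which inherits the extension property.\<close>

lemma nonvanishing_extension_compact_Suc:
  fixes A :: "'a::{metric_space,second_countable_topology} set"
  assumes "compact A"
    and base: "\<And>x e. \<lbrakk>x \<in> A; e > 0\<rbrakk> \<Longrightarrow>
      \<exists>U. openin (top_of_set A) U \<and> x \<in> U \<and> U \<subseteq> ball x e \<and>
        nonvanishing_extension (top_of_set A frontier_of U) k"
  shows "nonvanishing_extension A (Suc k)"
proof (rule nonvanishing_extension_Suc)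
  have clA: "closed A" using assms(1) by (rule compact_imp_closed)
  then show "closed A" .
  fix D E
  assume DE: "closed D" "closed E" "D \<subseteq> A" "E \<subseteq> A" "D \<inter> E = {}"
  have "\<exists>U. openin (top_of_set A) U \<and> x \<in> U \<and> closure U \<inter> E = {} \<and>
        nonvanishing_extension (top_of_set A frontier_of U) k" if xD: "x \<in> D" for x
  proof -
    have "open (- E)" "x \<in> - E" using DE xD by auto
    then obtain e where e: "e > 0" "cball x e \<subseteq> - E" using open_contains_cball by metis
    obtain U where U: "openin (top_of_set A) U" "x \<in> U" "U \<subseteq> ball x e"
      "nonvanishing_extension (top_of_set A frontier_of U) k"
      using base[of x e] subsetD[OF DE(3) xD] e(1) by metis
    have "closure U \<subseteq> cball x e"
      using U(3) by (intro closure_minimal) auto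
    then show ?thesis using U e(2) by blast
  qed
  then obtain N where N: "\<And>x. x \<in> D \<Longrightarrow> openin (top_of_set A) (N x) \<and> x \<in> N x \<and> closure (N x) \<inter> E = {} \<and>
        nonvanishing_extension (top_of_set A frontier_of (N x)) k"
    by metis
  have "compact D" using DE assms(1) by (metis closed_Int_compact inf.absorb_iff1)
  have "\<exists>T. open T \<and> N x = A \<inter> T" if "x \<in> D" for x
    using N[OF that] by (auto simp: openin_open)
  then obtain Q where Q: "\<And>x. x \<in> D \<Longrightarrow> open (Q x) \<and> N x = A \<inter> Q x" by metis
  have "D \<subseteq> (\<Union>x\<in>D. Q x)" using N Q by blast
  then obtain F where F: "F \<subseteq> D" "finite F" "D \<subseteq> (\<Union>x\<in>F. Q x)"
    using compactE_image[OF \<open>compact D\<close>, of D Q] Q by blast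
  define U where "U = (\<Union>x\<in>F. N x)"
  define K where "K = (\<Union>x\<in>F. closure (N x))"
  have "closed K" unfolding K_def using F(2) by auto
  have UK: "U \<subseteq> K" unfolding U_def K_def using closure_subset by blast
  show "\<exists>U V. openin (top_of_set A) U \<and> openin (top_of_set A) V \<and> U \<inter> V = {} \<and> D \<subseteq> U \<and> E \<subseteq> V \<and>
        nonvanishing_extension (A - U - V) k"
  proof (intro exI conjI)
    show "openin (top_of_set A) U" unfolding U_def using N F(1) by blast
    show "openin (top_of_set A) (A - K)" using \<open>closed K\<close>
      by (simp add: Diff_eq open_Compl openin_open_Int)
    show "U \<inter> (A - K) = {}" using UK by blast
    show "D \<subseteq> U" using F Q DE(3) unfolding U_def by blast
    show "E \<subseteq> A - K" unfolding K_def using N F(1) DE(4) by blast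
    have cf: "closed (top_of_set A frontier_of (N x))" for x
      using clA closedin_frontier_of closedin_closed_eq by blast
    have "A - U - (A - K) \<subseteq> (\<Union>x\<in>F. top_of_set A frontier_of (N x))"
    proof
      fix y assume "y \<in> A - U - (A - K)"
      then obtain x where x: "x \<in> F" "y \<in> closure (N x)" "y \<in> A" "y \<notin> N x"
        by (auto simp: U_def K_def)
      have "N x \<subseteq> A" using N[of x] x F(1) openin_imp_subset by blast
      then have "y \<in> top_of_set A closure_of (N x)"
        using x by (simp add: closure_of_subtopology Int_absorb1)
      moreover have "top_of_set A interior_of (N x) = N x"
        using N[of x] x(1) F(1) by (auto simp: interior_of_eq)
      ultimately show "y \<in> (\<Union>x\<in>F. top_of_set A frontier_of (N x))"
        using x by (auto simp: frontier_of_def)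
    qed
    moreover have "nonvanishing_extension (\<Union>((\<lambda>x. top_of_set A frontier_of (N x)) ` F)) k"
      using F N cf by (intro nonvanishing_extension_Union) auto
    ultimately show "nonvanishing_extension (A - U - (A - K)) k"
      using nonvanishing_extension_subset by blast
  qed
qed

text \<open>The shift by one starts the induction at the empty space, of dimension
  \<open>-1\<close>: a tuple of no functions is without common zero only there.\<close>

theorem dimension_le_imp_nonvanishing_extension:
  fixes A :: "'a::{metric_space,second_countable_topology} set"
  assumes "compact A" "top_of_set A dim_le int k - 1"
  shows "nonvanishing_extension A k"
  using assms
proof (induction k arbitrary: A)
  case 0
  then show ?case by (simp add: nonvanishing_extension_0 flip: subtopology_trivial_iff)
      (metis topspace_euclidean_subtopology topspace_discrete_topology)
next
  case (Suc k)
  have dim: "top_of_set A dim_le int k" using Suc.prems by simp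
  show ?case
  proof (rule nonvanishing_extension_compact_Suc[OF \<open>compact A\<close>])
    fix x e assume "x \<in> A" "(0::real) < e"
    then have "openin (top_of_set A) (A \<inter> ball x e)" "x \<in> A \<inter> ball x e" by auto
    then obtain U where U: "x \<in> U" "U \<subseteq> A \<inter> ball x e" "openin (top_of_set A) U"
      "subtopology (top_of_set A) (top_of_set A frontier_of U) dim_le int k - 1"
      using dim unfolding dimension_le.simps[of _ "int k"] by metis
    have sub: "top_of_set A frontier_of U \<subseteq> A"
      by (metis frontier_of_subset_topspace topspace_euclidean_subtopology)
    have "closedin (top_of_set A) (top_of_set A frontier_of U)" by (rule closedin_frontier_of)
    then have "compact (top_of_set A frontier_of U)"
      using \<open>compact A\<close> closedin_compact by blast
    moreover have "top_of_set (top_of_set A frontier_of U) dim_le int k - 1"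
      using U(4) sub by (simp add: subtopology_subtopology Int_absorb1)
    ultimately show "\<exists>U. openin (top_of_set A) U \<and> x \<in> U \<and> U \<subseteq> ball x e \<and>
        nonvanishing_extension (top_of_set A frontier_of U) k"
      using Suc.IH U by blast
  qed
qed

text \<open>Unlike in the definition, there is one more coordinate function than the dimension
  parameter: the maps go to a sphere of higher dimension, are therefore inessential, and
  extend to the whole space. The open set \<open>W\<close> extends the partition of \<open>A\<close> by the sign of the last
  coordinate.\<close>

lemma nonvanishing_extension_to_space:
  fixes A :: "'a::{metric_space,second_countable_topology} set"
  assumes "compact A" and ext: "nonvanishing_extension A k"
    and cont: "\<And>i. i < Suc k \<Longrightarrow> continuous_on A (f i)"
    and nz: "\<And>x. x \<in> A \<Longrightarrow> \<exists>i<Suc k. f i x \<noteq> 0"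
  obtains g where "\<And>i. i < Suc k \<Longrightarrow> continuous_on UNIV (g i :: 'a \<Rightarrow> real)"
    "\<And>i x. i < Suc k \<Longrightarrow> x \<in> A \<Longrightarrow> g i x = f i x" "\<And>x. \<exists>i<Suc k. g i x \<noteq> 0"
proof -
  have clA: "closed A" using assms(1) by (rule compact_imp_closed)
  define Z where "Z = (\<Inter>i\<in>{..<k}. {x \<in> A. f i x = 0}) \<inter> A"
  have "closed {x \<in> A. f i x = 0}" if "i < k" for i
    using continuous_closed_preimage_constant[of A "f i" 0] clA cont[of i] that by auto
  then have "closed Z" using clA by (auto simp: Z_def)
  then have "compact Z" using assms(1) closed_Int_compact[of Z A]
    by (simp add: Z_def Int_assoc)
  have "f k x \<noteq> 0" if "x \<in> Z" for x
    using that nz[of x] less_Suc_eq by (auto simp: Z_def)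
  then have pos: "\<bar>f k x\<bar> > 0" if "x \<in> Z" for x using that by simp
  \<comment> \<open>A margin: where \<open>\<bar>f k\<bar> \<le> e\<close>, the first
    \<open>k\<close> coordinates alone have no common zero. The minimum of
    \<open>\<bar>f k\<bar>\<close> on \<open>Z\<close> is halved to make the inequality
    strict.\<close>
  obtain e where e: "e > 0" "\<And>x. x \<in> Z \<Longrightarrow> \<bar>f k x\<bar> > e"
  proof (cases "Z = {}")
    case False
    have "continuous_on Z (\<lambda>x. \<bar>f k x\<bar>)"
      using cont[of k] by (intro continuous_intros) (auto simp: Z_def intro: continuous_on_subset)
    then obtain z where z: "z \<in> Z" "\<And>x. x \<in> Z \<Longrightarrow> \<bar>f k z\<bar> \<le> \<bar>f k x\<bar>"
      using continuous_attains_inf[OF \<open>compact Z\<close> False] by blast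
    show ?thesis
      using that[of "\<bar>f k z\<bar> / 2"] pos[OF z(1)] z(2) by force
  qed (use that[of 1] in auto)
  define S where "S = {x \<in> A. \<bar>f k x\<bar> \<le> e}"
  have S: "closed S" "S \<subseteq> A"
    using continuous_closed_preimage[OF cont[of k] clA, of "{-e..e}"]
    by (auto simp: S_def vimage_def Int_def abs_le_iff minus_le_iff conj_commute)
  have "\<exists>i<k. f i x \<noteq> 0" if "x \<in> S" for x
    using that e(2)[of x] by (force simp: S_def Z_def)
  note Snz = this
  \<comment> \<open>\<open>g0\<close> is tied to \<open>f\<close> only on \<open>S\<close>; in
    exchange it has no common zero anywhere on \<open>A\<close>.\<close>
  obtain g0 where g0: "\<And>i. i < k \<Longrightarrow> continuous_on A (g0 i)"
    "\<And>i x. i < k \<Longrightarrow> x \<in> S \<Longrightarrow> g0 i x = f i x" "\<And>x. x \<in> A \<Longrightarrow> \<exists>i<k. g0 i x \<noteq> 0"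
    by (rule nonvanishing_extensionD[OF ext S, of f])
      (use S(2) Snz in \<open>auto intro: continuous_on_subset[OF cont]\<close>)
  obtain G where G: "\<And>i. i < k \<Longrightarrow> continuous_on UNIV (G i)"
    "\<And>i x. i < k \<Longrightarrow> x \<in> A \<Longrightarrow> G i x = g0 i x"
    using Tietze_real_family[of A k g0] clA g0(1) by blast
  \<comment> \<open>The zeros of \<open>G\<close> are put on the negative side. A separator
    \<open>L\<close> of \<open>P\<close> and \<open>N\<close> then contains none of them, and it
    meets \<open>A\<close> only in \<open>S\<close>, where \<open>f\<close> and \<open>G\<close>
    agree and can be glued.\<close>
  define P where "P = {x \<in> A. f k x \<ge> 0}"
  define N where "N = {x \<in> A. f k x \<le> - e} \<union> (\<Inter>i\<in>{..<k}. {x. G i x = 0})"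
  have "closed {x. G i x = 0}" if "i < k" for i
    using continuous_closed_preimage_constant[of UNIV "G i" 0] G(1)[OF that] by simp
  then have "closed (\<Inter>i\<in>{..<k}. {x. G i x = 0})" by auto
  moreover have "closed {x \<in> A. f k x \<le> - e}" "closed P"
    using continuous_closed_preimage[OF cont[of k] clA, of "{..-e}"]
      continuous_closed_preimage[OF cont[of k] clA, of "{0..}"]
    by (auto simp: P_def vimage_def Int_def)
  ultimately have clPN: "closed P" "closed N" unfolding N_def by auto
  have GA: "\<exists>i<k. G i x \<noteq> 0" if "x \<in> A" for x
    using that G(2) g0(3) by metis
  have "P \<inter> N = {}" using GA e(1) by (fastforce simp: P_def N_def)
  then obtain W W' where W: "open W" "open W'" "P \<subseteq> W" "N \<subseteq> W'" "W \<inter> W' = {}"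
    using clPN t4_space[of P N] by blast
  define L where "L = - W - W'"
  have clL: "closed L" using W by (auto simp: L_def)
  have LA: "x \<in> S" if "x \<in> L \<inter> A" for x
  proof -
    have "x \<notin> P" "x \<notin> N" using that W(3,4) by (auto simp: L_def)
    then show ?thesis using that by (auto simp: P_def N_def S_def)
  qed
  have eq: "f i x = G i x" if "i < k" "x \<in> A" "x \<in> L" for i x
    using that LA[of x] G(2) g0(2) by simp
  obtain h where h: "\<And>i. i < k \<Longrightarrow> continuous_on (A \<union> L) (h i)"
    "\<And>i x. i < k \<Longrightarrow> x \<in> A \<Longrightarrow> h i x = f i x" "\<And>i x. i < k \<Longrightarrow> x \<in> L \<Longrightarrow> h i x = G i x"
    by (rule glue_closed[of A L k f G])
      (use clA clL eq cont continuous_on_subset[OF G(1)] in auto)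
  obtain H where H: "\<And>i. i < k \<Longrightarrow> continuous_on UNIV (H i)"
    "\<And>i x. i < k \<Longrightarrow> x \<in> A \<union> L \<Longrightarrow> H i x = h i x"
    using Tietze_real_family[of "A \<union> L" k h] clA clL h(1) by blast
  \<comment> \<open>The zero set of the new first \<open>k\<close> coordinates misses
    \<open>L\<close>, so it splits into a part in \<open>W\<close> and a part in \<open>W'\<close>,
    on which the last coordinate may take opposite signs. On \<open>A\<close> these are the signs of
    \<open>f k\<close>, because there \<open>Y\<close> lies in \<open>Z\<close>, where
    \<open>\<bar>f k\<bar> > e\<close>.\<close>
  define Y where "Y = (\<Inter>i\<in>{..<k}. {x. H i x = 0})"
  have "closed {x. H i x = 0}" if "i < k" for i
    using continuous_closed_preimage_constant[of UNIV "H i" 0] H(1)[OF that] by simp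
  then have clY: "closed Y" unfolding Y_def by auto
  have YL: "Y \<inter> L = {}"
  proof (rule ccontr)
    assume "Y \<inter> L \<noteq> {}"
    then obtain x where x: "x \<in> Y" "x \<in> L" by blast
    then have "\<forall>i<k. G i x = 0" using H(2) h(3) by (auto simp: Y_def)
    then have "x \<in> N" by (auto simp: N_def)
    then show False using x W by (auto simp: L_def)
  qed
  have YA: "x \<in> Z" if "x \<in> A" "x \<in> Y" for x
    using that H(2) h(2) by (auto simp: Y_def Z_def)
  have pos: "f k x > 0" if "x \<in> A \<inter> (Y - W')" for x
    using that e(2)[OF YA[of x]] e(1) W(4) by (force simp: N_def)
  have neg: "f k x < 0" if "x \<in> A \<inter> (Y - W)" for x
    using that W(3) by (force simp: P_def)
  have disj: "(Y - W') \<inter> (Y - W) = {}" using YL by (auto simp: L_def)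
  obtain F where F: "continuous_on UNIV F" "\<And>x. x \<in> A \<Longrightarrow> F x = f k x"
    "\<And>x. x \<in> (Y - W') \<union> (Y - W) \<Longrightarrow> F x \<noteq> 0"
    by (rule Tietze_signed[of A "Y - W'" "Y - W" "f k"])
      (use clA clY W(1,2) cont[of k] pos neg disj in auto)
  show ?thesis
  proof
    show "continuous_on UNIV ((H(k := F)) i)" if "i < Suc k" for i
      using that H(1)[of i] F(1) by (auto simp: less_Suc_eq)
    show "(H(k := F)) i x = f i x" if "i < Suc k" "x \<in> A" for i x
      using that H(2)[of i x] h(2)[of i x] F(2) by (auto simp: less_Suc_eq)
    show "\<exists>i<Suc k. (H(k := F)) i x \<noteq> 0" for x
    proof (cases "x \<in> Y")
      case True
      then have "F x \<noteq> 0" using W(5) by (intro F(3)) auto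
      then show ?thesis by (intro exI[of _ k]) simp
    next
      case False
      then obtain i where "i < k" "H i x \<noteq> 0" by (auto simp: Y_def)
      then show ?thesis by (intro exI[of _ i]) auto
    qed
  qed
qed

section \<open>Boxes, cubes and their boundaries\<close>

text \<open>Degenerate intervals are allowed, so that the finite-dimensional cubes and the Hilbert
  cube are instances of the same product.\<close>

definition hbox :: "(nat \<Rightarrow> real) \<Rightarrow> (nat \<Rightarrow> real) \<Rightarrow> (nat \<Rightarrow> real) set" where
  "hbox l u = {x. \<forall>i. l i \<le> x i \<and> x i \<le> u i}"

lemma compact_hbox: "compact (hbox l u)"
proof -
  have "compactin (product_topology (\<lambda>_. euclidean) UNIV) (PiE UNIV (\<lambda>i. {l i..u i}))"
    by (subst compactin_PiE) (simp add: compactin_euclidean_iff)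
  moreover have "PiE UNIV (\<lambda>i. {l i..u i}) = hbox l u"
    by (auto simp: hbox_def PiE_def Pi_def)
  ultimately show ?thesis by (simp add: euclidean_product_topology compactin_euclidean_iff)
qed

lemma closed_hbox: "closed (hbox l u)"
  by (simp add: compact_hbox compact_imp_closed)

lemma connected_hbox: "connected (hbox l u)"
proof -
  have "path_connected (hbox l u)"
    unfolding path_connected_def
  proof (intro ballI)
    fix x y assume xy: "x \<in> hbox l u" "y \<in> hbox l u"
    define g where "g = (\<lambda>t i. (1 - t) * x i + t * y i :: real)"
    have "path g" unfolding path_def g_def by (intro continuous_intros)
    moreover have "g t \<in> hbox l u" if "t \<in> {0..1}" for t
    proof -
      have "(1 - t) * l i + t * l i \<le> g t i \<and> g t i \<le> (1 - t) * u i + t * u i" for i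
        unfolding g_def using that xy
        by (intro conjI add_mono mult_left_mono) (auto simp: hbox_def)
      then show ?thesis by (simp add: hbox_def algebra_simps)
    qed
    ultimately show "\<exists>g. path g \<and> path_image g \<subseteq> hbox l u \<and> pathstart g = x \<and> pathfinish g = y"
      by (intro exI[of _ g]) (auto simp: path_image_def pathstart_def pathfinish_def g_def)
  qed
  then show ?thesis by (rule path_connected_imp_connected)
qed

text \<open>Clipping finitely many coordinates of a box leaves a box, which is again compact and
  connected; this is the source of local connectedness.\<close>

lemma hbox_nbhd:
  assumes "x \<in> hbox l u" "open V" "x \<in> V"
  obtains a b T where "hbox a b \<subseteq> V \<inter> hbox l u" "open T" "x \<in> T" "T \<inter> hbox l u \<subseteq> hbox a b"
proof -
  have "openin (product_topology (\<lambda>_. euclidean) UNIV) V"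
    using assms(2) by (simp add: euclidean_product_topology)
  then obtain X where X: "x \<in> PiE UNIV X" "\<And>i. open (X i)" "finite {i. X i \<noteq> UNIV}" "PiE UNIV X \<subseteq> V"
    using product_topology_open_contains_basis[OF _ assms(3), of "\<lambda>_. euclidean" UNIV] by auto
  define F where "F = {i. X i \<noteq> UNIV}"
  have "\<exists>e>0. cball (x i) e \<subseteq> X i" for i
    using X(1) X(2)[of i] by (auto simp: open_contains_cball PiE_def Pi_def)
  then obtain e where e: "\<And>i. e i > 0" "\<And>i. cball (x i) (e i) \<subseteq> X i" by metis
  define a where "a = (\<lambda>i. if i \<in> F then max (l i) (x i - e i) else l i)"
  define b where "b = (\<lambda>i. if i \<in> F then min (u i) (x i + e i) else u i)"
  define T where "T = (\<Inter>i\<in>F. {y. \<bar>y i - x i\<bar> < e i})"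
  show ?thesis
  proof
    have "y \<in> V" if "y \<in> hbox a b" for y
    proof -
      have "y i \<in> X i" for i
      proof (cases "i \<in> F")
        case True
        have "a i \<le> y i \<and> y i \<le> b i" using that by (simp add: hbox_def)
        then have "y i \<in> cball (x i) (e i)"
          using True by (simp add: a_def b_def dist_real_def abs_le_iff)
        then show ?thesis using e(2) by blast
      qed (simp add: F_def)
      then show ?thesis using X(4) by auto
    qed
    moreover have "y \<in> hbox l u" if "y \<in> hbox a b" for y
    proof -
      have bd: "a i \<le> y i" "y i \<le> b i" "l i \<le> a i" "b i \<le> u i" for i
        using that by (auto simp: hbox_def a_def b_def)
      have "l i \<le> y i \<and> y i \<le> u i" for i
        by (intro conjI order_trans[OF bd(3) bd(1)] order_trans[OF bd(2) bd(4)])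
      then show ?thesis by (simp add: hbox_def)
    qed
    ultimately show "hbox a b \<subseteq> V \<inter> hbox l u" by blast
    have "open {y::nat \<Rightarrow> real. \<bar>y i - x i\<bar> < e i}" for i
      by (intro open_Collect_less continuous_intros) auto
    then show "open T" unfolding T_def using X(3) by (auto simp: F_def)
    show "x \<in> T" using e(1) by (auto simp: T_def)
    show "T \<inter> hbox l u \<subseteq> hbox a b"
    proof
      fix y assume y: "y \<in> T \<inter> hbox l u"
      have "a i \<le> y i \<and> y i \<le> b i" for i
      proof (cases "i \<in> F")
        case True
        then have "\<bar>y i - x i\<bar> < e i" using y by (simp add: T_def)
        then show ?thesis using y True by (auto simp: a_def b_def hbox_def)
      qed (use y in \<open>auto simp: a_def b_def hbox_def\<close>)
      then show "y \<in> hbox a b" by (simp add: hbox_def)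
    qed
  qed
qed

lemma locally_hbox: "locally (\<lambda>K. compact K \<and> connected K) (hbox l u)"
  unfolding locally_def
proof (intro allI impI)
  fix w x assume w: "openin (top_of_set (hbox l u)) w \<and> x \<in> w"
  then obtain V where V: "open V" "w = hbox l u \<inter> V" by (auto simp: openin_open)
  then obtain a b T where "hbox a b \<subseteq> V \<inter> hbox l u" "open T" "x \<in> T" "T \<inter> hbox l u \<subseteq> hbox a b"
    using hbox_nbhd[of x l u V] w by blast
  then show "\<exists>u' v. openin (top_of_set (hbox l u)) u' \<and> (compact v \<and> connected v) \<and> x \<in> u' \<and> u' \<subseteq> v \<and> v \<subseteq> w"
    using V w by (intro exI[of _ "T \<inter> hbox l u"] exI[of _ "hbox a b"])
      (auto simp: compact_hbox connected_hbox openin_open)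
qed

text \<open>Normalising \<open>h\<close> would retract the whole space onto the sphere. Shrinking
  the sphere linearly to the origin and retracting at every stage would then contract it within
  itself.\<close>

lemma no_nonvanishing_extension_of_sphere:
  fixes h :: "nat \<Rightarrow> (nat \<Rightarrow> real) \<Rightarrow> real"
  assumes cont: "\<And>i. i \<le> n \<Longrightarrow> continuous_on UNIV (h i)"
    and nz: "\<And>x. \<exists>i\<le>n. h i x \<noteq> 0"
    and sphere: "\<And>x i. \<lbrakk>(\<Sum>i\<le>n. (x i)\<^sup>2) = 1; \<And>i. i > n \<Longrightarrow> x i = 0; i \<le> n\<rbrakk> \<Longrightarrow> h i x = x i"
  shows False
proof -
  define S where "S = {x::nat \<Rightarrow> real. (\<Sum>i\<le>n. (x i)\<^sup>2) = 1 \<and> (\<forall>i>n. x i = 0)}"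
  have nS: "nsphere n = top_of_set S"
    by (simp add: nsphere S_def euclidean_product_topology)
  define r where "r = (\<lambda>y. sqrt (\<Sum>j\<le>n. (h j y)\<^sup>2))"
  have rpos: "r y > 0" for y
    unfolding r_def using nz[of y] by (auto intro!: sum_pos2)
  have r2: "(r y)\<^sup>2 = (\<Sum>j\<le>n. (h j y)\<^sup>2)" for y
    unfolding r_def by (simp add: sum_nonneg)
  define f where "f = (\<lambda>y i. if i \<le> n then h i y / r y else 0)"
  have fS: "f y \<in> S" for y
  proof -
    have "(\<Sum>i\<le>n. (f y i)\<^sup>2) = (\<Sum>i\<le>n. (h i y)\<^sup>2) / (r y)\<^sup>2"
      by (simp add: f_def power_divide sum_divide_distrib)
    also have "\<dots> = 1" using rpos[of y] by (simp flip: r2)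
    finally show ?thesis by (simp add: S_def f_def)
  qed
  have contr: "continuous_on UNIV r"
    unfolding r_def using cont by (intro continuous_intros) auto
  have "continuous_on UNIV (\<lambda>y. f y i)" for i
    unfolding f_def using cont[of i] contr rpos
    by (cases "i \<le> n") (auto intro!: continuous_intros simp: less_imp_neq[symmetric])
  then have contf: "continuous_on UNIV f"
    by (rule continuous_on_coordinatewise_then_product)
  have id: "f x = x" if "x \<in> S" for x
  proof -
    have h: "h i x = x i" if "i \<le> n" for i
      using sphere[of x i] that \<open>x \<in> S\<close> by (auto simp: S_def)
    then have "r x = 1" using \<open>x \<in> S\<close> by (simp add: r_def S_def)
    then show ?thesis using h \<open>x \<in> S\<close> by (auto simp: f_def S_def)
  qed
  define H where "H = (\<lambda>z::real \<times> (nat \<Rightarrow> real). f (\<lambda>j. (1 - fst z) * snd z j))"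
  have "continuous_on UNIV (\<lambda>z::real \<times> (nat \<Rightarrow> real). \<lambda>j. (1 - fst z) * snd z j)"
    by (intro continuous_intros continuous_on_product_then_coordinatewise)
  then have "continuous_on UNIV H"
    unfolding H_def by (rule continuous_on_compose2[OF contf]) auto
  then have "homotopic_with_canon (\<lambda>_. True) S S id (\<lambda>_. f (\<lambda>_. 0))"
  proof (subst homotopic_with, simp, intro exI[of _ H] conjI)
    assume "continuous_on UNIV H"
    then show "continuous_map (prod_topology (top_of_set {0..1}) (top_of_set S)) (top_of_set S) H"
      using fS by (auto simp: H_def intro: continuous_on_subset)
  qed (use id in \<open>auto simp: H_def\<close>)
  then have "contractible S" by (auto simp: contractible_def)
  then show False
    using non_contractible_space_nsphere[of n] by (simp add: nS)
qed

text \<open>Indexed like \<open>nsphere n\<close>: the coordinates \<open>0\<close> to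
  \<open>n\<close> vary, so this is the \<open>(n + 1)\<close>-cube and its boundary has dimension
  \<open>n\<close>.\<close>

definition cube :: "nat \<Rightarrow> (nat \<Rightarrow> real) set" where
  "cube n = hbox (\<lambda>i. if i \<le> n then -1 else 0) (\<lambda>i. if i \<le> n then 1 else 0)"

definition cube_boundary :: "nat \<Rightarrow> (nat \<Rightarrow> real) set" where
  "cube_boundary n = {x \<in> cube n. \<exists>i\<le>n. \<bar>x i\<bar> = 1}"

lemma cube_iff: "x \<in> cube n \<longleftrightarrow> (\<forall>i\<le>n. \<bar>x i\<bar> \<le> 1) \<and> (\<forall>i>n. x i = 0)"
proof
  assume "x \<in> cube n"
  then have x: "(if i \<le> n then -1 else 0) \<le> x i \<and> x i \<le> (if i \<le> n then 1 else 0)" for i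
    by (simp add: cube_def hbox_def)
  have "\<bar>x i\<bar> \<le> 1" if "i \<le> n" for i using x[of i] that by (simp add: abs_le_iff)
  moreover have "x i = 0" if "i > n" for i using x[of i] that by simp
  ultimately show "(\<forall>i\<le>n. \<bar>x i\<bar> \<le> 1) \<and> (\<forall>i>n. x i = 0)" by blast
qed (auto simp: cube_def hbox_def abs_le_iff)

lemma closed_cube_boundary: "closed (cube_boundary n)"
proof -
  have "cube_boundary n = cube n \<inter> (\<Union>i\<in>{..n}. {x. \<bar>x i\<bar> = 1})"
    by (auto simp: cube_boundary_def)
  moreover have "closed {x::nat\<Rightarrow>real. \<bar>x i\<bar> = 1}" for i
    by (intro closed_Collect_eq continuous_intros) auto
  ultimately show ?thesis by (auto simp: cube_def intro!: closed_Int closed_hbox)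
qed

text \<open>Weaker than the sharp bound \<open>1 / sqrt (n + 1)\<close>, but free of roots; it
  determines how far a sphere must be blown up to leave the cube.\<close>

lemma sphere_has_large_coordinate:
  fixes x :: "nat \<Rightarrow> real"
  assumes "(\<Sum>i\<le>n. (x i)\<^sup>2) = 1"
  shows "\<exists>i\<le>n. \<bar>x i\<bar> * (n + 1) \<ge> 1"
proof (rule ccontr)
  assume no: "\<not> ?thesis"
  have lt: "\<bar>x i\<bar> < 1 / (real n + 1)" if "i \<le> n" for i
  proof -
    have "\<bar>x i\<bar> * (real n + 1) < 1" using no that by (metis not_le of_nat_1 of_nat_add)
    then show ?thesis by (simp add: pos_less_divide_eq)
  qed
  have "(x i)\<^sup>2 < 1 / (real n + 1)" if "i \<le> n" for i
  proof -
    have "1 / (real n + 1) \<le> 1" by (simp add: field_simps)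
    then have "\<bar>x i\<bar> * \<bar>x i\<bar> \<le> \<bar>x i\<bar> * 1" using lt[OF that] by (intro mult_left_mono) linarith+
    then show ?thesis using lt[OF that] by (simp add: power2_eq_square flip: abs_mult)
  qed
  then have "(\<Sum>i\<le>n. (x i)\<^sup>2) < (\<Sum>i\<le>n. 1 / (real n + 1))"
    by (intro sum_strict_mono) auto
  then show False using assms by (simp add: field_simps)
qed

text \<open>If the component of \<open>p\<close> missed the boundary, an extension of \<open>x \<mapsto> x - p\<close> from \<open>A\<close> to that
  component without zeros, together with \<open>x \<mapsto> x - p\<close> elsewhere, would contradict Brouwer's
  no-retraction theorem.\<close>

lemma component_meets_cube_boundary:
  assumes "closed A" "A \<subseteq> cube n" "nonvanishing_extension A n" "p \<in> cube n" "p \<notin> A"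
  shows "\<exists>b\<in>cube_boundary n. connected_component (cube n - A) p b"
proof (rule ccontr)
  assume no: "\<not> ?thesis"
  define Y where "Y = cube n"
  have clY: "closed Y" and cpY: "compact Y" by (simp_all add: Y_def cube_def closed_hbox compact_hbox)
  define U where "U = connected_component_set (Y - A) p"
  have UY: "U \<subseteq> Y - A" unfolding U_def by (rule connected_component_subset)
  have pU: "p \<in> U" using assms by (simp add: U_def Y_def)
  have opA: "openin (top_of_set Y) (Y - A)"
    using assms(1) by (simp add: Diff_eq open_Compl openin_open_Int)
  \<comment> \<open>Local connectedness makes the component \<open>U\<close> open in
    \<open>Y\<close>, and like every component it is closed in \<open>Y - A\<close>. Hence
    \<open>U \<union> A\<close> and \<open>Y - U\<close> are closed; they overlap exactly in
    \<open>A\<close>, where the two maps to be glued agree.\<close>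
  have "locally connected Y"
    unfolding Y_def cube_def by (rule locally_mono[OF locally_hbox]) simp
  then have "locally connected (Y - A)" using opA by (rule locally_open_subset)
  then have "openin (top_of_set (Y - A)) U"
    unfolding U_def using assms(4,5) by (intro openin_connected_component_locally_connected)
  then have opU: "openin (top_of_set Y) U" using opA by (rule openin_trans)
  have "closedin (top_of_set (Y - A)) U"
    unfolding U_def by (rule closedin_connected_component)
  then have "openin (top_of_set (Y - A)) (Y - A - U)"
    by (metis closedin_def topspace_euclidean_subtopology)
  then have "openin (top_of_set Y) (Y - A - U)" using opA by (rule openin_trans)
  then have "closedin (top_of_set Y) (Y - (Y - A - U))"
    by (metis closedin_diff closedin_topspace topspace_euclidean_subtopology)
  moreover have "Y - (Y - A - U) = U \<union> A" using UY assms(2) by (auto simp: Y_def)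
  ultimately have clUA: "closed (U \<union> A)" using clY closedin_closed_trans by fastforce
  have clYU: "closed (Y - U)"
    using opU clY by (metis closedin_closed_trans closedin_diff closedin_topspace topspace_euclidean_subtopology)
  have ne: "\<exists>i\<le>n. x i - p i \<noteq> 0" if "x \<in> Y" "x \<noteq> p" for x
  proof (rule ccontr)
    assume "\<not> ?thesis"
    then have "x i = p i" for i
      using that assms(4) by (cases "i \<le> n") (auto simp: Y_def cube_iff)
    then show False using that by auto
  qed
  then have ne': "\<exists>i\<le>n. x i - p i \<noteq> 0" if "x \<in> A" for x
    using that assms(2,5) unfolding Y_def by blast
  have cpA: "compact A" using assms(1,2) cpY by (metis Y_def closed_Int_compact inf.absorb_iff1)
  have contf: "continuous_on S (\<lambda>x. x i - p i)" for S :: "(nat \<Rightarrow> real) set" and i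
    by (rule continuous_on_subset[of UNIV]) (auto intro!: continuous_intros)
  \<comment> \<open>\<open>cube n\<close> has \<open>Suc n\<close> coordinates, one more than the
    parameter \<open>n\<close> of the extension property.\<close>
  obtain g where g: "\<And>i. i < Suc n \<Longrightarrow> continuous_on UNIV (g i :: (nat \<Rightarrow> real) \<Rightarrow> real)"
    "\<And>i x. i < Suc n \<Longrightarrow> x \<in> A \<Longrightarrow> g i x = x i - p i" "\<And>x. \<exists>i<Suc n. g i x \<noteq> 0"
    by (rule nonvanishing_extension_to_space[OF cpA assms(3), of "\<lambda>i x. x i - p i"])
      (use ne' contf in \<open>auto simp: less_Suc_eq_le\<close>)
  obtain h where h0: "\<And>i. i < Suc n \<Longrightarrow> continuous_on ((U \<union> A) \<union> (Y - U)) (h i)"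
    and hg: "\<And>i x. i < Suc n \<Longrightarrow> x \<in> U \<union> A \<Longrightarrow> h i x = g i x"
    and hf: "\<And>i x. i < Suc n \<Longrightarrow> x \<in> Y - U \<Longrightarrow> h i x = x i - p i"
    by (rule glue_closed[of "U \<union> A" "Y - U" "Suc n" g "\<lambda>i x. x i - p i"])
      (use clUA clYU g contf in \<open>auto intro: continuous_on_subset[OF g(1)]\<close>)
  have "(U \<union> A) \<union> (Y - U) = Y" using UY assms(2) by (auto simp: Y_def)
  then have h: "\<And>i. i < Suc n \<Longrightarrow> continuous_on Y (h i)" using h0 by simp
  have hnz: "\<exists>i\<le>n. h i x \<noteq> 0" if xY: "x \<in> Y" for x
  proof (cases "x \<in> U")
    case True
    then show ?thesis using g(3)[of x] hg[of _ x] by (auto simp: less_Suc_eq_le)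
  next
    case False
    then have "x \<noteq> p" using pU by metis
    then obtain i where "i \<le> n" "x i - p i \<noteq> 0" using ne[OF xY] by metis
    then show ?thesis using False xY hf[of i x] by (intro exI[of _ i]) auto
  qed
  \<comment> \<open>Coordinatewise clamping retracts the space onto the cube.\<close>
  define c :: "(nat \<Rightarrow> real) \<Rightarrow> (nat \<Rightarrow> real)" where
    "c = (\<lambda>x i. if i \<le> n then max (-1) (min 1 (x i)) else 0)"
  have cY: "c x \<in> Y" for x by (auto simp: c_def Y_def cube_iff)
  have contci: "continuous_on UNIV (\<lambda>x. c x i)" for i
    unfolding c_def by (cases "i \<le> n") (auto intro!: continuous_intros)
  have contc: "continuous_on UNIV c" using contci by (rule continuous_on_coordinatewise_then_product)
  \<comment> \<open>Outside the cube, in the first \<open>n + 1\<close> coordinates, the clamped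
    point lies on the boundary, hence off \<open>U\<close>, where \<open>h\<close> is
    \<open>x \<mapsto> x - p\<close>; adding the displacement \<open>x - c x\<close> turns
    \<open>F\<close> into \<open>x \<mapsto> x - p\<close> there.\<close>
  define F where "F = (\<lambda>i x. h i (c x) + (x i - c x i))"
  have contF: "continuous_on UNIV (F i)" if "i \<le> n" for i
  proof -
    have "continuous_on UNIV (\<lambda>x. h i (c x))"
      using that cY by (intro continuous_on_compose2[OF h contc]) auto
    then show ?thesis
      unfolding F_def by (intro continuous_on_add continuous_on_diff contci) auto
  qed
  have Fout: "F i x = x i - p i" if "j \<le> n" "\<bar>x j\<bar> > 1" "i \<le> n" for i j x
  proof -
    have "\<bar>c x j\<bar> = 1" using that by (auto simp: c_def max_def min_def)
    then have "c x \<in> cube_boundary n" using cY[of x] that(1) by (auto simp: cube_boundary_def Y_def)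
    then have "c x \<in> Y - U" using no cY[of x] by (auto simp: U_def Y_def)
    then show ?thesis using hf[of i "c x"] that by (simp add: F_def less_Suc_eq_le)
  qed
  have Fnz: "\<exists>i\<le>n. F i x \<noteq> 0" for x
  proof (cases "\<exists>j\<le>n. \<bar>x j\<bar> > 1")
    case True
    then obtain j where j: "j \<le> n" "\<bar>x j\<bar> > 1" by blast
    moreover have "\<bar>p j\<bar> \<le> 1" using assms(4) j by (simp add: cube_iff)
    ultimately show ?thesis using Fout[of j x j] by (intro exI[of _ j]) auto
  next
    case False
    have "c x i = x i" if "i \<le> n" for i
    proof -
      have "\<bar>x i\<bar> \<le> 1" using False that by (meson not_le)
      then show ?thesis using that by (simp add: c_def abs_le_iff)
    qed
    then show ?thesis using hnz[OF cY[of x]] by (auto simp: F_def)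
  qed
  \<comment> \<open>The factor \<open>n + 1\<close> cancels the bound on the largest coordinate,
    which becomes at least \<open>3\<close> in absolute value; as
    \<open>\<bar>p j\<bar> \<le> 1\<close>, the sphere of radius \<open>r\<close> around
    \<open>p\<close> lies outside the cube.\<close>
  define r where "r = 3 * (real n + 1)"
  have r: "r > 0" by (simp add: r_def)
  show False
  proof (rule no_nonvanishing_extension_of_sphere[of n "\<lambda>i x. F i (\<lambda>j. p j + r * x j) / r"])
    fix i assume "i \<le> n"
    have "continuous_on UNIV (\<lambda>x j. p j + r * x j)"
      by (intro continuous_intros continuous_on_product_coordinates)
    then show "continuous_on UNIV (\<lambda>x. F i (\<lambda>j. p j + r * x j) / r)"
      using r by (intro continuous_intros continuous_on_compose2[OF contF[OF \<open>i \<le> n\<close>]]) auto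
  next
    fix x show "\<exists>i\<le>n. F i (\<lambda>j. p j + r * x j) / r \<noteq> 0"
      using Fnz[of "\<lambda>j. p j + r * x j"] r by auto
  next
    fix x :: "nat \<Rightarrow> real" and i
    assume x: "(\<Sum>i\<le>n. (x i)\<^sup>2) = 1" and "i \<le> n"
    obtain j where j: "j \<le> n" "\<bar>x j\<bar> * (n + 1) \<ge> 1" using sphere_has_large_coordinate[OF x] by blast
    have "\<bar>r * x j\<bar> \<ge> 3" using j by (simp add: r_def abs_mult algebra_simps)
    moreover have "\<bar>p j\<bar> \<le> 1" using assms(4) j by (simp add: cube_iff)
    ultimately have "\<bar>p j + r * x j\<bar> > 1" by linarith
    then show "F i (\<lambda>j. p j + r * x j) / r = x i"
      using Fout[of j "\<lambda>j. p j + r * x j" i] j \<open>i \<le> n\<close> r by simp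
  qed
qed

text \<open>\<open>J\<close> lists the free coordinates of a flat, \<open>c\<close> fixes the
  others. Finite unions of flats are general enough for the induction: the walls of a suitable small
  box cut each flat in flats with one free coordinate fewer.\<close>

lemma dimension_le_subset_flats:
  fixes S :: "(nat \<Rightarrow> real) set"
  assumes "finite F" "\<And>J c. (J, c) \<in> F \<Longrightarrow> finite J \<and> card J < k"
    "S \<subseteq> (\<Union>(J, c)\<in>F. {x. \<forall>i. i \<notin> J \<longrightarrow> x i = c i})"
  shows "top_of_set S dim_le int k - 1"
  using assms
proof (induction k arbitrary: F S)
  case 0
  then have "F = {}" by fastforce
  then have "S = {}" using 0 by auto
  then show ?case by simp
next
  case (Suc k)
  show ?case
  proof (rule dimension_le.intros)
    show "- 1 \<le> int (Suc k) - 1" by simp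
    fix V a assume V: "openin (top_of_set S) V" "a \<in> V"
    then obtain W where W: "open W" "V = S \<inter> W" by (auto simp: openin_open)
    have "openin (product_topology (\<lambda>_. euclidean) UNIV) W"
      using W(1) by (simp add: euclidean_product_topology)
    then obtain X where X: "a \<in> PiE UNIV X" "\<And>i. open (X i)" "finite {i. X i \<noteq> UNIV}" "PiE UNIV X \<subseteq> W"
      using product_topology_open_contains_basis[of "\<lambda>_. euclidean" UNIV W a] V(2) W(2) by auto
    define M where "M = {i. X i \<noteq> UNIV}"
    \<comment> \<open>The half-width \<open>d\<close> avoids the finitely many distances from
      \<open>a i\<close> to the values \<open>c i\<close>, so a wall of the box meets no flat on
      which coordinate \<open>i\<close> is fixed.\<close>
    have "\<exists>d>0. cball (a i) d \<subseteq> X i \<and> (\<forall>(J, c)\<in>F. c i \<noteq> a i - d \<and> c i \<noteq> a i + d)" for i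
    proof -
      obtain e where e: "e > 0" "cball (a i) e \<subseteq> X i"
        using X(1) X(2)[of i] unfolding open_contains_cball by (metis PiE_mem UNIV_I)
      have "infinite ({0<..<e} - (\<lambda>(J, c). \<bar>c i - a i\<bar>) ` F)"
        using Suc.prems(1) e(1) by (intro Diff_infinite_finite) auto
      then obtain d where d: "d \<in> {0<..<e} - (\<lambda>(J, c). \<bar>c i - a i\<bar>) ` F"
        by (metis equals0I finite.emptyI)
      have "cball (a i) d \<subseteq> X i" using e(2) d by force
      moreover have "c i \<noteq> a i - d \<and> c i \<noteq> a i + d" if "(J, c) \<in> F" for J c
      proof -
        have "d \<noteq> \<bar>c i - a i\<bar>" using d that by force
        then show ?thesis using d by auto
      qed
      ultimately show ?thesis using d by auto
    qed
    then obtain d where d: "\<And>i. d i > 0" "\<And>i. cball (a i) (d i) \<subseteq> X i"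
      "\<And>i J c. (J, c) \<in> F \<Longrightarrow> c i \<noteq> a i - d i \<and> c i \<noteq> a i + d i"
      by (metis (mono_tags, lifting) case_prodD)
    define B where "B = (\<Inter>i\<in>M. {y::nat\<Rightarrow>real. \<bar>y i - a i\<bar> < d i})"
    define C where "C = (\<Inter>i\<in>M. {y::nat\<Rightarrow>real. \<bar>y i - a i\<bar> \<le> d i})"
    have "open {y::nat \<Rightarrow> real. \<bar>y i - a i\<bar> < d i}" "closed {y::nat \<Rightarrow> real. \<bar>y i - a i\<bar> \<le> d i}" for i
      by (intro open_Collect_less closed_Collect_le continuous_intros; auto)+
    then have BC: "open B" "closed C" unfolding B_def C_def using X(3) by (auto simp: M_def)
    define U where "U = S \<inter> B"
    have opU: "openin (top_of_set S) U" using BC by (auto simp: U_def openin_open)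
    \<comment> \<open>The intersections of flats with walls: a free coordinate \<open>i\<close>
      becomes fixed at one of the two ends \<open>a i - d i\<close>,
      \<open>a i + d i\<close>.\<close>
    define F' where "F' = (\<lambda>((J, c), i, s). (J - {i}, c(i := a i + s * d i))) `
      {z \<in> F \<times> M \<times> {-1, 1::real}. fst (snd z) \<in> fst (fst z)}"
    have front: "top_of_set S frontier_of U \<subseteq> (\<Union>(J, c)\<in>F'. {x. \<forall>i. i \<notin> J \<longrightarrow> x i = c i})"
    proof
      fix y assume y: "y \<in> top_of_set S frontier_of U"
      have "closedin (top_of_set S) (S \<inter> C)" using BC by (auto simp: closedin_closed)
      moreover have "U \<subseteq> S \<inter> C" by (force simp: U_def B_def C_def)
      ultimately have "top_of_set S closure_of U \<subseteq> S \<inter> C" by (rule closure_of_minimal[rotated])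
      moreover have "y \<in> top_of_set S closure_of U" "y \<notin> U"
        using y opU by (auto simp: frontier_of_def interior_of_openin)
      ultimately have "y \<in> S" "y \<in> C" "y \<notin> B" by (auto simp: U_def)
      then obtain i where i: "i \<in> M" "\<bar>y i - a i\<bar> = d i" by (force simp: B_def C_def)
      obtain J c where Jc: "(J, c) \<in> F" "\<And>i. i \<notin> J \<Longrightarrow> y i = c i"
        using \<open>y \<in> S\<close> Suc.prems(3) by fastforce
      obtain s :: real where s: "s \<in> {-1, 1}" "y i = a i + s * d i"
      proof (cases "y i \<ge> a i")
        case True then show ?thesis using that[of 1] i by simp
      next
        case False then show ?thesis using that[of "-1"] i by simp
      qed
      have "i \<in> J"
        using Jc(2)[of i] d(3)[OF Jc(1), of i] s by (cases "i \<in> J") auto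
      then have "(J - {i}, c(i := a i + s * d i)) \<in> F'"
        unfolding F'_def using Jc(1) i(1) s(1)
        by (intro image_eqI[of _ _ "((J, c), i, s)"]) auto
      moreover have "\<forall>j. j \<notin> J - {i} \<longrightarrow> y j = (c(i := a i + s * d i)) j"
        using Jc(2) s(2) by auto
      ultimately show "y \<in> (\<Union>(J, c)\<in>F'. {x. \<forall>i. i \<notin> J \<longrightarrow> x i = c i})" by blast
    qed
    have sub: "top_of_set S frontier_of U \<subseteq> S"
      by (metis frontier_of_subset_topspace topspace_euclidean_subtopology)
    have "top_of_set (top_of_set S frontier_of U) dim_le int k - 1"
    proof (rule Suc.IH[OF _ _ front])
      show "finite F'"
        unfolding F'_def using Suc.prems(1) X(3) by (intro finite_imageI) (auto simp: M_def)
      fix J' c' assume "(J', c') \<in> F'"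
      then obtain J c i where "(J, c) \<in> F" "i \<in> J" "J' = J - {i}" by (auto simp: F'_def)
      then show "finite J' \<and> card J' < k"
        using Suc.prems(2)[of J c] card_Diff1_less[of J i] by fastforce
    qed
    then have "subtopology (top_of_set S) (top_of_set S frontier_of U) dim_le int (Suc k) - 1 - 1"
      using sub by (simp add: subtopology_subtopology Int_absorb1)
    moreover have "a \<in> U" using V W d(1) by (auto simp: U_def B_def)
    moreover have "U \<subseteq> V"
    proof
      fix y assume y: "y \<in> U"
      have "y i \<in> X i" for i
      proof (cases "i \<in> M")
        case True
        then have "y i \<in> cball (a i) (d i)" using y by (auto simp: U_def B_def dist_real_def)
        then show ?thesis using d(2) by blast
      qed (simp add: M_def)
      then have "y \<in> W" using X(4) by auto
      then show "y \<in> V" using y W by (simp add: U_def)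
    qed
    ultimately show "\<exists>U. a \<in> U \<and> U \<subseteq> V \<and> openin (top_of_set S) U \<and>
        subtopology (top_of_set S) (top_of_set S frontier_of U) dim_le int (Suc k) - 1 - 1"
      using opU by blast
  qed
qed

text \<open>The faces lie in flats with \<open>n\<close> free coordinates. For the lower bound, a
  boundary of dimension at most \<open>n - 1\<close> could not cut the origin off from itself, by
  \<open>component_meets_cube_boundary\<close>.\<close>

lemma has_dimension_cube_boundary: "has_dimension (top_of_set (cube_boundary n)) n"
proof -
  define F :: "(nat set \<times> (nat \<Rightarrow> real)) set" where
    "F = (\<lambda>(i, s). ({..n} - {i}, (\<lambda>_. 0)(i := s))) ` ({..n} \<times> {-1, 1})"
  have "top_of_set (cube_boundary n) dim_le int (Suc n) - 1"
  proof (rule dimension_le_subset_flats)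
    show "finite F" by (simp add: F_def)
    show "finite J \<and> card J < Suc n" if "(J, c) \<in> F" for J c
      using that by (auto simp: F_def)
    show "cube_boundary n \<subseteq> (\<Union>(J, c)\<in>F. {x. \<forall>i. i \<notin> J \<longrightarrow> x i = c i})"
    proof
      fix x assume x: "x \<in> cube_boundary n"
      then obtain i where i: "i \<le> n" "\<bar>x i\<bar> = 1" by (auto simp: cube_boundary_def)
      have "({..n} - {i}, (\<lambda>_. 0)(i := x i)) \<in> F"
        unfolding F_def using i by (intro image_eqI[of _ _ "(i, x i)"]) auto
      moreover have "\<forall>j. j \<notin> {..n} - {i} \<longrightarrow> x j = ((\<lambda>_. 0)(i := x i)) j"
        using x by (auto simp: cube_boundary_def cube_iff)
      ultimately show "x \<in> (\<Union>(J, c)\<in>F. {x. \<forall>i. i \<notin> J \<longrightarrow> x i = c i})" by blast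
    qed
  qed
  moreover have "\<not> top_of_set (cube_boundary n) dim_le int n - 1"
  proof
    assume dim: "top_of_set (cube_boundary n) dim_le int n - 1"
    have sub: "cube_boundary n \<subseteq> cube n" by (auto simp: cube_boundary_def)
    have "compact (cube_boundary n)"
      using sub closed_cube_boundary compact_hbox unfolding cube_def
      by (metis closed_Int_compact inf.absorb_iff1)
    then have "nonvanishing_extension (cube_boundary n) n"
      using dim by (rule dimension_le_imp_nonvanishing_extension)
    moreover have "(\<lambda>_. 0) \<in> cube n" "(\<lambda>_. 0) \<notin> cube_boundary n"
      by (auto simp: cube_boundary_def cube_iff)
    ultimately obtain b where "b \<in> cube_boundary n"
      "connected_component (cube n - cube_boundary n) (\<lambda>_. 0) b"
      using component_meets_cube_boundary[OF closed_cube_boundary sub] by blast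
    then show False using connected_component_in by blast
  qed
  ultimately show ?thesis by (simp add: has_dimension_def)
qed

section \<open>A sequence of copies glued along a closed set\<close>

text \<open>The connected set witnessing the component need be neither compact nor a neighbourhood
  of \<open>x\<close>. Chaining small compact connected sets along it yields both; compactness will
  allow \<open>W\<close> to be moved to nearby copies.\<close>

lemma connected_nbhd_meeting_component:
  fixes Y :: "'a::topological_space set"
  assumes loc: "locally (\<lambda>K. compact K \<and> connected K) Y"
    and G: "openin (top_of_set Y) G" and comp: "connected_component G x b"
  obtains W T where "compact W" "connected W" "W \<subseteq> G" "b \<in> W"
    "openin (top_of_set Y) T" "x \<in> T" "T \<subseteq> W"
proof -
  define P where "P = (\<lambda>y. \<exists>W T. compact W \<and> connected W \<and> W \<subseteq> G \<and> y \<in> W \<and>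
    openin (top_of_set Y) T \<and> x \<in> T \<and> T \<subseteq> W)"
  obtain K where K: "connected K" "K \<subseteq> G" "x \<in> K" "b \<in> K"
    using comp by (auto simp: connected_component_def)
  have nb: "\<exists>u v. openin (top_of_set Y) u \<and> (compact v \<and> connected v) \<and> a \<in> u \<and> u \<subseteq> v \<and> v \<subseteq> G"
    if "a \<in> K" for a
    using loc G that K(2) unfolding locally_def by blast
  have GY: "G \<subseteq> Y" using G openin_imp_subset by blast
  have "P b"
  proof (rule connected_induction_simple[OF K(1,3,4)])
    show "P x" using nb[OF K(3)] unfolding P_def by blast
    fix a assume "a \<in> K"
    obtain u v where uv: "openin (top_of_set Y) u" "compact v" "connected v" "a \<in> u" "u \<subseteq> v" "v \<subseteq> G"
      using nb[OF \<open>a \<in> K\<close>] by blast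
    have "P z" if yz: "y \<in> u" "z \<in> u" and "P y" for y z
    proof -
      obtain W T where W: "compact W" "connected W" "W \<subseteq> G" "y \<in> W"
        "openin (top_of_set Y) T" "x \<in> T" "T \<subseteq> W"
        using \<open>P y\<close> unfolding P_def by blast
      have "connected (W \<union> v)" using W uv yz by (intro connected_Un) auto
      moreover have "compact (W \<union> v)" using W uv by (intro compact_Un) auto
      ultimately show ?thesis
        unfolding P_def using W uv yz by (intro exI[of _ "W \<union> v"] exI[of _ T]) auto
    qed
    moreover have "openin (top_of_set K) (K \<inter> u)"
      using uv(1) K(2) GY by (metis openin_open Int_left_absorb inf.absorb_iff1 inf_assoc subset_trans)
    ultimately show "\<exists>T. openin (top_of_set K) T \<and> a \<in> T \<and> (\<forall>x\<in>T. \<forall>y\<in>T. P x \<longrightarrow> P y)"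
      using uv(4) \<open>a \<in> K\<close> by blast
  qed
  then show ?thesis using that unfolding P_def by blast
qed

section \<open>The glued space\<close>

definition heights :: "real set" where
  "heights = insert 0 (range (\<lambda>k. inverse (real (Suc k))))"

definition copy_point :: "(nat \<Rightarrow> real) set \<Rightarrow> real \<Rightarrow> (nat \<Rightarrow> real) \<Rightarrow> nat \<Rightarrow> real" where
  "copy_point B t y = (\<lambda>i. case i of 0 \<Rightarrow> t * infdist y B | Suc j \<Rightarrow> y j)"

text \<open>The copy of \<open>Y\<close> at height \<open>t\<close> is the graph of \<open>t\<close> times the distance to \<open>B\<close>, so all copies share
  exactly the points over \<open>B\<close>.\<close>

definition copies :: "(nat \<Rightarrow> real) set \<Rightarrow> real set \<Rightarrow> (nat \<Rightarrow> real) set \<Rightarrow> (nat \<Rightarrow> real) set" where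
  "copies B D W = (\<lambda>(t, y). copy_point B t y) ` (D \<times> W)"

lemma compact_heights: "compact heights"
  unfolding heights_def by (rule compact_sequence_with_limit[OF LIMSEQ_inverse_real_of_nat])

lemma countable_heights: "countable heights"
  unfolding heights_def by simp

lemma zero_in_heights: "0 \<in> heights"
  by (simp add: heights_def)

lemma heights_isolated:
  assumes "t \<in> heights" "t \<noteq> 0"
  obtains d where "d > 0" "\<And>s. s \<in> heights \<Longrightarrow> \<bar>s - t\<bar> < d \<Longrightarrow> s = t"
proof -
  have t: "t > 0" using assms by (auto simp: heights_def)
  have "s \<in> (\<lambda>k. inverse (real (Suc k))) ` {..nat \<lceil>2 / t\<rceil>}" if s: "s \<in> heights" "s > t / 2" for s
  proof -
    obtain k where k: "s = inverse (real (Suc k))" using s t by (auto simp: heights_def)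
    have "real (Suc k) < 2 / t" using s(2) t unfolding k by (simp add: field_simps)
    then have "k \<le> nat \<lceil>2 / t\<rceil>" by linarith
    then show ?thesis using k by auto
  qed
  then have "{s \<in> heights. s > t / 2} \<subseteq> (\<lambda>k. inverse (real (Suc k))) ` {..nat \<lceil>2 / t\<rceil>}"
    by blast
  then have "finite {s \<in> heights. s > t / 2}"
    by (rule finite_subset) simp
  then obtain d where d: "d > 0" "\<forall>s\<in>{s \<in> heights. s > t / 2}. s \<noteq> t \<longrightarrow> d \<le> dist t s"
    using finite_set_avoid by metis
  show ?thesis
  proof
    show "min d (t / 2) > 0" using d t by simp
    fix s assume s: "s \<in> heights" "\<bar>s - t\<bar> < min d (t / 2)"
    then have "s > t / 2" by arith
    then show "s = t" using d(2) s by (force simp: dist_real_def abs_minus_commute)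
  qed
qed

lemma copy_point_simps [simp]:
  "copy_point B t y 0 = t * infdist y B" "copy_point B t y (Suc i) = y i"
  by (simp_all add: copy_point_def)

lemma copy_point_eq_0: "y \<in> B \<Longrightarrow> copy_point B t y = copy_point B 0 y"
  by (auto simp: copy_point_def fun_eq_iff split: nat.split)

lemma continuous_on_copy_point: "continuous_on S (\<lambda>(t, y). copy_point B t y)"
proof (rule continuous_on_coordinatewise_then_product)
  fix i
  show "continuous_on S (\<lambda>x. (case x of (t, y) \<Rightarrow> copy_point B t y) i)"
  proof (cases i)
    case 0
    then show ?thesis
      by (simp add: case_prod_unfold) (intro continuous_intros)
  next
    case (Suc j)
    have "continuous_on S (\<lambda>x. snd x j)"
      by (rule continuous_on_product_then_coordinatewise[OF continuous_on_snd[OF continuous_on_id]])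
    then show ?thesis using Suc by (simp add: case_prod_unfold)
  qed
qed

lemma continuous_on_copy_point_snd: "continuous_on S (copy_point B t)"
proof -
  have "continuous_on S (\<lambda>y. (t, y))" by (intro continuous_on_Pair continuous_on_const continuous_on_id)
  from continuous_on_compose2[OF continuous_on_copy_point this subset_UNIV, of B]
  show ?thesis by simp
qed

lemma continuous_on_shift: "continuous_on S (\<lambda>(x :: nat \<Rightarrow> real) i. x (Suc i))"
  by (intro continuous_on_coordinatewise_then_product continuous_on_subset[OF continuous_on_product_coordinates]) auto

lemma shift_copy_point: "(\<lambda>i. copy_point B t y (Suc i)) = y"
  by simp

lemma compact_copies: "compact D \<Longrightarrow> compact W \<Longrightarrow> compact (copies B D W)"
  unfolding copies_def by (intro compact_continuous_image continuous_on_copy_point compact_Times)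

lemma connected_copy: "connected W \<Longrightarrow> connected (copy_point B t ` W)"
  by (intro connected_continuous_image continuous_on_copy_point_snd)

lemma copies_eq_Union: "copies B D W = (\<Union>t\<in>D. copy_point B t ` W)"
  by (auto simp: copies_def)

text \<open>All the copies of \<open>W\<close> pass through the one point over
  \<open>b\<close>.\<close>

lemma connected_copies:
  assumes "connected W" "b \<in> W" "b \<in> B"
  shows "connected (copies B D W)"
  unfolding copies_eq_Union
proof (rule connected_Union)
  show "connected S" if "S \<in> (\<lambda>t. copy_point B t ` W) ` D" for S
    using that assms(1) connected_copy by auto
  have "copy_point B 0 b \<in> copy_point B t ` W" for t
    using assms(2) copy_point_eq_0[OF assms(3), of t] by (metis imageI)
  then show "\<Inter>((\<lambda>t. copy_point B t ` W) ` D) \<noteq> {}" by blast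
qed

section \<open>Aposyndesis of the glued space\<close>

lemma continuum_top_of_set:
  fixes T :: "'a::metric_space set"
  shows "continuum (top_of_set T) \<longleftrightarrow> compact T \<and> connected T"
  using compactin_subspace[of euclidean T] connectedin_def[of euclidean T]
  by (simp add: continuum_def metrizable_space_subtopology metrizable_space_euclidean)

lemma subcontinuum_of_top_of_set:
  fixes T :: "'a::metric_space set"
  shows "subcontinuum_of T (top_of_set X) \<longleftrightarrow> T \<subseteq> X \<and> compact T \<and> connected T"
  by (auto simp: subcontinuum_of_def subtopology_subtopology Int_absorb1 continuum_top_of_set)

lemma interior_of_top_of_setI:
  assumes "open Q" "x \<in> Q" "x \<in> X" "X \<inter> Q \<subseteq> T"
  shows "x \<in> top_of_set X interior_of T"
  unfolding interior_of_def using assms by (auto intro: openin_open_Int)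

lemma continuum_copies:
  assumes "compact Y" "connected Y" "B \<subseteq> Y" "B \<noteq> {}"
  shows "continuum (top_of_set (copies B heights Y))"
  using assms compact_copies[OF compact_heights] connected_copies
  by (auto simp: continuum_top_of_set)

text \<open>The hypothesis \<open>meets\<close> serves the points of the limit copy off
  \<open>B\<close>. A point over \<open>B\<close> has neighbourhoods made of all copies of one small
  connected set containing it, and a point off \<open>B\<close> at a positive height has
  neighbourhoods within its own copy.\<close>

lemma closed_set_aposyndetic_copies:
  assumes Y: "compact Y" "locally (\<lambda>K. compact K \<and> connected K) Y"
    and B: "closed B" "B \<subseteq> Y" "B \<noteq> {}"
    and meets: "\<And>A y. \<lbrakk>A \<in> \<F>; closed A; A \<subseteq> copies B heights Y; y \<in> Y; y \<notin> B; copy_point B 0 y \<notin> A\<rbrakk>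
      \<Longrightarrow> \<exists>b\<in>B. connected_component (Y - copy_point B 0 -` A) y b"
  shows "closed_set_aposyndetic (top_of_set (copies B heights Y)) \<F>"
  unfolding closed_set_aposyndetic_def topspace_euclidean_subtopology
proof (intro ballI allI impI, elim conjE)
  define X where "X = copies B heights Y"
  fix x A
  assume "x \<in> copies B heights Y" "closedin (top_of_set (copies B heights Y)) A" and AF: "A \<in> \<F>"
    and "A \<subseteq> copies B heights Y - {x}"
  then have x: "x \<in> X" and A: "closed A" "A \<subseteq> X" "x \<notin> A"
    using closedin_closed_trans compact_copies[OF compact_heights Y(1), THEN compact_imp_closed]
    by (auto simp: X_def)
  have XI: "copy_point B s z \<in> X" if "s \<in> heights" "z \<in> Y" for s z
    using that by (auto simp: X_def copies_def)
  have XE: "\<exists>s z. s \<in> heights \<and> z \<in> Y \<and> x' = copy_point B s z" if "x' \<in> X" for x'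
    using that by (auto simp: X_def copies_def)
  define Q where "Q = {p. (case p of (t, y) \<Rightarrow> copy_point B t y) \<notin> A}"
  have "open ((\<lambda>(t, y). copy_point B t y) -` (- A))"
    using continuous_on_copy_point[of UNIV B] A(1) by (intro open_vimage) auto
  then have opQ: "open Q" by (simp add: Q_def vimage_def)
  have nbhd: "\<exists>u v. open u \<and> y \<in> u \<and> compact v \<and> connected v \<and> Y \<inter> u \<subseteq> v \<and> v \<subseteq> V \<inter> Y"
    if "y \<in> Y" "y \<in> V" "open V" for y V
  proof -
    have "openin (top_of_set Y) (Y \<inter> V)" using that by (simp add: openin_open_Int)
    then have "\<exists>u v. openin (top_of_set Y) u \<and> (compact v \<and> connected v) \<and> y \<in> u \<and> u \<subseteq> v \<and> v \<subseteq> Y \<inter> V"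
      using \<open>y \<in> Y\<close> \<open>y \<in> V\<close> by (intro Y(2)[unfolded locally_def, rule_format]) auto
    then obtain u v where "openin (top_of_set Y) u" "compact v" "connected v" "y \<in> u" "u \<subseteq> v" "v \<subseteq> Y \<inter> V"
      by blast
    then show ?thesis by (auto simp: openin_open)
  qed
  have shift: "open {x'. (\<lambda>i. x' (Suc i)) \<in> u}" if "open u" for u :: "(nat \<Rightarrow> real) set"
    using open_vimage[OF that continuous_on_shift] by (simp add: vimage_def)
  have cinf: "continuous_on UNIV (\<lambda>x'::nat\<Rightarrow>real. infdist (\<lambda>i. x' (Suc i)) B)"
    by (intro continuous_intros continuous_on_shift)
  obtain t y where ty: "t \<in> heights" "y \<in> Y" "x = copy_point B t y" using XE[OF x] by blast
  have "\<exists>T Q'. T \<subseteq> X \<and> compact T \<and> connected T \<and> open Q' \<and> x \<in> Q' \<and> X \<inter> Q' \<subseteq> T \<and> T \<inter> A = {}"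
  proof (cases "y \<in> B")
    case True
    have xs: "copy_point B s y = x" for s
      using copy_point_eq_0[OF True] ty(3) by metis
    \<comment> \<open>The swap puts the compact factor \<open>heights\<close> second for the tube
      lemma: one small set around \<open>y\<close> avoids \<open>A\<close> at all heights at
      once.\<close>
    have "open ((\<lambda>(y, t). (t, y)) -` Q)"
      unfolding case_prod_unfold
      by (intro open_vimage[OF opQ] continuous_on_Pair continuous_on_fst continuous_on_snd continuous_on_id)
    moreover have "{y} \<times> heights \<subseteq> (\<lambda>(y, t). (t, y)) -` Q"
      using A(3) xs by (auto simp: Q_def)
    ultimately obtain V where V: "y \<in> V" "open V" "V \<times> heights \<subseteq> (\<lambda>(y, t). (t, y)) -` Q"
      using Elementary_Topology.tube_lemma[OF compact_heights] by metis
    obtain u v where uv: "open u" "y \<in> u" "compact v" "connected v" "Y \<inter> u \<subseteq> v" "v \<subseteq> V \<inter> Y"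
      using nbhd[OF ty(2) V(1,2)] by blast
    have yv: "y \<in> v" using uv ty by blast
    show ?thesis
    proof (intro exI conjI)
      show "copies B heights v \<subseteq> X" using uv(6) by (auto simp: X_def copies_def)
      show "compact (copies B heights v)" using compact_heights uv(3) by (rule compact_copies)
      show "connected (copies B heights v)" using uv(4) yv True by (rule connected_copies)
      show "open {x'. (\<lambda>i. x' (Suc i)) \<in> u}" using uv(1) by (rule shift)
      show "x \<in> {x'. (\<lambda>i. x' (Suc i)) \<in> u}" using uv(2) ty by simp
      show "X \<inter> {x'. (\<lambda>i. x' (Suc i)) \<in> u} \<subseteq> copies B heights v"
      proof
        fix x' assume x': "x' \<in> X \<inter> {x'. (\<lambda>i. x' (Suc i)) \<in> u}"
        then obtain s z where sz: "s \<in> heights" "z \<in> Y" "x' = copy_point B s z" using XE by blast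
        then have "z \<in> v" using x' uv(5) by auto
        then show "x' \<in> copies B heights v" using sz by (auto simp: copies_def)
      qed
      show "copies B heights v \<inter> A = {}" using V(3) uv(6) by (fastforce simp: copies_def Q_def)
    qed
  next
    case yB: False
    have dy: "infdist y B > 0"
      using yB B in_closed_iff_infdist_zero[of B y] infdist_nonneg[of y B] by fastforce
    show ?thesis
    proof (cases "t = 0")
      case True
      obtain b where b: "b \<in> B" "connected_component (Y - copy_point B 0 -` A) y b"
        using meets[OF AF A(1) _ ty(2) yB] A ty(3) True by (auto simp: X_def)
      have "openin (top_of_set Y) (Y - copy_point B 0 -` A)"
        using continuous_on_copy_point_snd[of UNIV B 0] A(1)
        by (simp add: Diff_eq openin_open_Int open_Compl closed_vimage)
      then obtain W T where W: "compact W" "connected W" "W \<subseteq> Y - copy_point B 0 -` A" "b \<in> W"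
        "openin (top_of_set Y) T" "y \<in> T" "T \<subseteq> W"
        using connected_nbhd_meeting_component[OF Y(2) _ b(2)] by metis
      obtain u where u: "open u" "T = Y \<inter> u" using W(5) by (auto simp: openin_open)
      have "{0} \<times> W \<subseteq> Q" using W(3) by (auto simp: Q_def)
      \<comment> \<open>The tube around \<open>{0} \<times> W\<close> provides the parallel copies
        of \<open>W\<close>: at all heights close to \<open>0\<close> they still avoid
        \<open>A\<close>.\<close>
      then obtain V where V: "0 \<in> V" "open V" "V \<times> W \<subseteq> Q"
        using Elementary_Topology.tube_lemma[OF W(1) opQ] by metis
      then obtain e where e: "e > 0" "cball 0 e \<subseteq> V" using open_contains_cball by blast
      define D where "D = heights \<inter> cball 0 e"
      \<comment> \<open>For \<open>x' = copy_point B s z\<close> the second condition reads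
        \<open>\<bar>s\<bar> * infdist z B < e * infdist z B\<close>, that is,
        \<open>\<bar>s\<bar> < e\<close> and \<open>z\<close> is off \<open>B\<close>; written
        without division it is visibly open.\<close>
      define Q' where "Q' = {x'. (\<lambda>i. x' (Suc i)) \<in> u} \<inter> {x'. \<bar>x' 0\<bar> < e * infdist (\<lambda>i. x' (Suc i)) B}"
      show ?thesis
      proof (intro exI conjI)
        show "copies B D W \<subseteq> X" using W(3) by (auto simp: X_def copies_def D_def)
        have "compact D" unfolding D_def using compact_heights by (intro compact_Int_closed) auto
        then show "compact (copies B D W)" using W(1) by (rule compact_copies)
        show "connected (copies B D W)" using W(2,4) b(1) by (rule connected_copies)
        show "open Q'"
          unfolding Q'_def by (intro open_Int shift u(1) open_Collect_less continuous_intros cinf) auto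
        show "x \<in> Q'" using u W(6) ty(3) True dy e(1) by (auto simp: Q'_def)
        show "X \<inter> Q' \<subseteq> copies B D W"
        proof
          fix x' assume x': "x' \<in> X \<inter> Q'"
          then obtain s z where sz: "s \<in> heights" "z \<in> Y" "x' = copy_point B s z" using XE by blast
          then have "z \<in> W" using x' u(2) W(7) by (auto simp: Q'_def)
          moreover have "\<bar>s\<bar> * infdist z B < e * infdist z B"
            using x' sz(3) by (simp add: Q'_def abs_mult infdist_nonneg)
          then have "\<bar>s\<bar> < e" using infdist_nonneg[of z B] by (simp add: mult_less_cancel_right)
          then have "s \<in> D" using sz(1) by (simp add: D_def dist_real_def)
          ultimately show "x' \<in> copies B D W" using sz by (auto simp: copies_def)
        qed
        show "copies B D W \<inter> A = {}" using V(3) e(2) by (fastforce simp: copies_def Q_def D_def)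
      qed
    next
      case False
      obtain d where d: "d > 0" "\<And>s. s \<in> heights \<Longrightarrow> \<bar>s - t\<bar> < d \<Longrightarrow> s = t"
        using heights_isolated[OF ty(1) False] by blast
      have "open (- (copy_point B t -` A))"
        using continuous_on_copy_point_snd[of UNIV B t] A(1) by (simp add: open_Compl closed_vimage)
      moreover have "y \<in> - (copy_point B t -` A)" using A(3) ty(3) by simp
      ultimately obtain u v where uv: "open u" "y \<in> u" "compact v" "connected v" "Y \<inter> u \<subseteq> v"
        "v \<subseteq> - (copy_point B t -` A) \<inter> Y"
        using nbhd[OF ty(2)] by metis
      \<comment> \<open>The same device singles out the isolated height \<open>t\<close>.\<close>
      define Q' where "Q' = {x'. (\<lambda>i. x' (Suc i)) \<in> u} \<inter>
        {x'. \<bar>x' 0 - t * infdist (\<lambda>i. x' (Suc i)) B\<bar> < d * infdist (\<lambda>i. x' (Suc i)) B}"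
      show ?thesis
      proof (intro exI conjI)
        show "copy_point B t ` v \<subseteq> X" using uv(6) ty(1) XI by blast
        show "compact (copy_point B t ` v)" using uv(3)
          by (intro compact_continuous_image continuous_on_copy_point_snd)
        show "connected (copy_point B t ` v)" using uv(4) by (rule connected_copy)
        show "open Q'"
          unfolding Q'_def by (intro open_Int shift uv(1) open_Collect_less continuous_intros cinf) auto
        show "x \<in> Q'" using uv(2) ty(3) dy d(1) by (auto simp: Q'_def)
        show "X \<inter> Q' \<subseteq> copy_point B t ` v"
        proof
          fix x' assume x': "x' \<in> X \<inter> Q'"
          then obtain s z where sz: "s \<in> heights" "z \<in> Y" "x' = copy_point B s z" using XE by blast
          then have "z \<in> v" using x' uv(5) by (auto simp: Q'_def)
          moreover have "\<bar>s - t\<bar> * infdist z B < d * infdist z B"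
            using x' sz(3) by (simp add: Q'_def abs_mult infdist_nonneg flip: left_diff_distrib)
          then have "\<bar>s - t\<bar> < d" using infdist_nonneg[of z B] by (simp add: mult_less_cancel_right)
          then have "s = t" using sz(1) d(2) by blast
          ultimately show "x' \<in> copy_point B t ` v" using sz by auto
        qed
        show "copy_point B t ` v \<inter> A = {}" using uv(6) by blast
      qed
    qed
  qed
  then obtain T Q' where "T \<subseteq> X" "compact T" "connected T" "open Q'" "x \<in> Q'" "X \<inter> Q' \<subseteq> T" "T \<inter> A = {}"
    by blast
  then show "\<exists>T. subcontinuum_of T (top_of_set (copies B heights Y)) \<and>
      x \<in> top_of_set (copies B heights Y) interior_of T \<and> T \<subseteq> copies B heights Y - A"
    using x interior_of_top_of_setI[of Q' x X T]
    by (auto simp: subcontinuum_of_top_of_set X_def)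
qed

text \<open>Off the glued set, the height \<open>x 0 / infdist \<dots>\<close> is continuous with countably many values, so
  it is constant on connected sets.\<close>

lemma not_closed_set_aposyndetic_copies:
  assumes B: "closed B" "B \<subseteq> Y" "B \<noteq> {}" "B \<noteq> Y" and F: "copy_point B 0 ` B \<in> \<F>" and "compact Y"
  shows "\<not> closed_set_aposyndetic (top_of_set (copies B heights Y)) \<F>"
proof
  define X where "X = copies B heights Y"
  define A where "A = copy_point B 0 ` B"
  assume "closed_set_aposyndetic (top_of_set (copies B heights Y)) \<F>"
  then have apo: "\<And>x A. \<lbrakk>x \<in> X; closedin (top_of_set X) A; A \<in> \<F>; A \<subseteq> X - {x}\<rbrakk> \<Longrightarrow>
      \<exists>T. subcontinuum_of T (top_of_set X) \<and> x \<in> top_of_set X interior_of T \<and> T \<subseteq> X - A"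
    by (auto simp: closed_set_aposyndetic_def X_def)
  obtain y where y: "y \<in> Y" "y \<notin> B" using B by blast
  define x where "x = copy_point B 0 y"
  have XI: "copy_point B s z \<in> X" if "s \<in> heights" "z \<in> Y" for s z
    using that by (auto simp: X_def copies_def)
  have "compact B" using B(1,2) \<open>compact Y\<close> by (metis closed_Int_compact inf.absorb_iff1)
  then have "compact A" unfolding A_def
    by (intro compact_continuous_image continuous_on_copy_point_snd)
  then have clA: "closed A" by (rule compact_imp_closed)
  have "x \<notin> A"
  proof
    assume "x \<in> A"
    then obtain b where "b \<in> B" "copy_point B 0 y = copy_point B 0 b" by (auto simp: A_def x_def)
    then show False using y(2) shift_copy_point by metis
  qed
  moreover have AX: "A \<subseteq> X" using B(2) XI[OF zero_in_heights] by (auto simp: A_def)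
  moreover have "closedin (top_of_set X) A" using clA AX by (rule closed_subset[rotated])
  moreover have "A \<in> \<F>" using F by (simp add: A_def)
  moreover have "x \<in> X" using XI[OF zero_in_heights y(1)] by (simp add: x_def)
  ultimately obtain T where T: "T \<subseteq> X" "connected T" "x \<in> top_of_set X interior_of T" "T \<inter> A = {}"
    using apo[of x A] unfolding subcontinuum_of_top_of_set by blast
  define r where "r = (\<lambda>x'::nat\<Rightarrow>real. x' 0 / infdist (\<lambda>i. x' (Suc i)) B)"
  \<comment> \<open>As \<open>T\<close> misses the copy \<open>A\<close> of \<open>B\<close>, the
    denominator of \<open>r\<close> has no zero on \<open>T\<close>.\<close>
  have inT: "infdist (\<lambda>i. x' (Suc i)) B \<noteq> 0 \<and> r x' \<in> heights" if x': "x' \<in> T" for x'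
  proof -
    obtain s z where sz: "s \<in> heights" "z \<in> Y" "x' = copy_point B s z"
      using T(1) x' by (auto simp: X_def copies_def)
    have "z \<notin> B"
    proof
      assume "z \<in> B"
      then have "x' \<in> A" using copy_point_eq_0[of z B s] sz(3) by (auto simp: A_def)
      then show False using T(4) x' by blast
    qed
    then have "infdist z B \<noteq> 0" using B in_closed_iff_infdist_zero by blast
    then show ?thesis using sz by (simp add: r_def)
  qed
  have "continuous_on T r"
    unfolding r_def using inT
    by (intro continuous_intros continuous_on_shift continuous_on_subset[OF continuous_on_product_coordinates]) auto
  then have conn: "connected (r ` T)" using T(2) by (rule connected_continuous_image)
  obtain Q where Q: "open Q" "x \<in> Q" "X \<inter> Q \<subseteq> T"
    using T(3) by (auto simp: interior_of_def openin_open)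
  \<comment> \<open>The points over \<open>y\<close> in the late copies converge to
    \<open>x\<close>, so the neighbourhood \<open>T\<close> contains one of them, and
    \<open>r\<close> takes a positive value on \<open>T\<close> besides \<open>0\<close>.\<close>
  have "(\<lambda>k. copy_point B (inverse (real (Suc k))) y) \<longlonglongrightarrow> copy_point B 0 y"
  proof -
    have "continuous_on UNIV (\<lambda>t. copy_point B t y)"
    proof -
      have "continuous_on UNIV (\<lambda>t::real. (t, y))"
        by (intro continuous_on_Pair continuous_on_const continuous_on_id)
      from continuous_on_compose2[OF continuous_on_copy_point this subset_UNIV, of B]
      show ?thesis by simp
    qed
    then have "isCont (\<lambda>t. copy_point B t y) 0" by (simp add: continuous_on_eq_continuous_at)
    then show ?thesis using LIMSEQ_inverse_real_of_nat by (rule isCont_tendsto_compose)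
  qed
  then have "\<forall>\<^sub>F k in sequentially. copy_point B (inverse (real (Suc k))) y \<in> Q"
    using Q(1,2) by (simp add: x_def topological_tendstoD)
  then obtain k where k: "copy_point B (inverse (real (Suc k))) y \<in> Q"
    using eventually_happens'[OF sequentially_bot] by blast
  have "inverse (real (Suc k)) \<in> heights" by (simp add: heights_def)
  then have kT: "copy_point B (inverse (real (Suc k))) y \<in> T" using k Q(3) XI y(1) by blast
  have xT: "x \<in> T" using Q \<open>x \<in> X\<close> by blast
  have "infdist y B \<noteq> 0" using B y in_closed_iff_infdist_zero by blast
  then have "r x = 0" "r (copy_point B (inverse (real (Suc k))) y) = inverse (real (Suc k))"
    by (simp_all add: r_def x_def)
  then have "uncountable (r ` T)"
    using connected_uncountable[OF conn imageI[OF xT] imageI[OF kT]] by simp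
  moreover have "r ` T \<subseteq> heights" using inT by blast
  ultimately show False using countable_heights countable_subset by blast
qed

section \<open>The examples\<close>

text \<open>The curves \<open>g s\<close> agree with the segment from \<open>x\<close> to \<open>b\<close> except in one coordinate \<open>j\<close>, where they
  bend towards \<open>s\<close>. They are disjoint off the endpoints, so a countable set meets only countably
  many of them.\<close>

lemma connected_component_hbox_minus_countable:
  assumes "countable A" "x \<in> hbox (\<lambda>_. 0) (\<lambda>_. 1) - A" "b \<in> hbox (\<lambda>_. 0) (\<lambda>_. 1) - A"
  shows "connected_component (hbox (\<lambda>_. 0) (\<lambda>_. 1) - A) x b"
proof (cases "x = b")
  case True
  then show ?thesis using assms by simp
next
  case False
  then obtain i where i: "x i \<noteq> b i" by (auto simp: fun_eq_iff)
  \<comment> \<open>Coordinate \<open>i\<close>, in which \<open>x\<close> and \<open>b\<close>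
    differ, reveals the time on a curve; the bending is therefore done in another
    coordinate.\<close>
  define j where "j = Suc i"
  \<comment> \<open>The weight \<open>4 * \<tau> * (1 - \<tau>)\<close> vanishes exactly at the
    endpoints and stays in \<open>[0, 1]\<close>, so coordinate \<open>j\<close> is a convex
    combination of the segment and \<open>s\<close>, and the curve remains in the cube.\<close>
  define g where "g = (\<lambda>s \<tau> k. if k = j
    then (1 - 4 * \<tau> * (1 - \<tau>)) * ((1 - \<tau>) * x k + \<tau> * b k) + (4 * \<tau> * (1 - \<tau>)) * s
    else (1 - \<tau>) * x k + \<tau> * b k :: real)"
  have convex: "0 \<le> (1 - c) * u + c * v \<and> (1 - c) * u + c * v \<le> 1"
    if "0 \<le> c" "c \<le> 1" "0 \<le> u" "u \<le> 1" "0 \<le> v" "v \<le> 1" for c u v :: real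
  proof -
    have "(1 - c) * u + c * v \<le> (1 - c) * 1 + c * 1"
      using that by (intro add_mono mult_left_mono) auto
    then show ?thesis using that by simp
  qed
  have par: "0 \<le> 4 * \<tau> * (1 - \<tau>) \<and> 4 * \<tau> * (1 - \<tau>) \<le> 1" if "\<tau> \<in> {0..1}" for \<tau> :: real
  proof -
    have "1 - 4 * \<tau> * (1 - \<tau>) = (1 - 2 * \<tau>)\<^sup>2" by (simp add: power2_eq_square algebra_simps)
    then have "4 * \<tau> * (1 - \<tau>) \<le> 1" by (metis diff_ge_0_iff_ge zero_le_power2)
    then show ?thesis using that by simp
  qed
  have xb: "0 \<le> x k" "x k \<le> 1" "0 \<le> b k" "b k \<le> 1" for k
    using assms(2,3) by (auto simp: hbox_def)
  have gY: "g s \<tau> \<in> hbox (\<lambda>_. 0) (\<lambda>_. 1)" if "s \<in> {0..1}" "\<tau> \<in> {0..1}" for s \<tau>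
  proof -
    have seg: "0 \<le> (1 - \<tau>) * x k + \<tau> * b k \<and> (1 - \<tau>) * x k + \<tau> * b k \<le> 1" for k
      using that xb[of k] by (intro convex) auto
    have "0 \<le> g s \<tau> k \<and> g s \<tau> k \<le> 1" for k
    proof (cases "k = j")
      case True
      show ?thesis unfolding g_def
        using True convex[of "4 * \<tau> * (1 - \<tau>)" "(1 - \<tau>) * x j + \<tau> * b j" s]
          par[OF that(2)] seg[of j] that(1) by auto
    next
      case False
      then show ?thesis using seg[of k] by (simp add: g_def)
    qed
    then show ?thesis by (simp add: hbox_def)
  qed
  have g0: "g s 0 = x" and g1: "g s 1 = b" for s by (auto simp: g_def)
  have gi: "g s \<tau> i = (1 - \<tau>) * x i + \<tau> * b i" for s \<tau> by (simp add: g_def j_def)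
  have uniq: "s = s'" if "g s \<tau> = g s' \<tau>'" "\<tau> \<in> {0..1}" "g s \<tau> \<noteq> x" "g s \<tau> \<noteq> b" for s s' \<tau> \<tau>'
  proof -
    have "(1 - \<tau>) * x i + \<tau> * b i = (1 - \<tau>') * x i + \<tau>' * b i"
      using that(1) gi by metis
    then have "(\<tau> - \<tau>') * (b i - x i) = 0" by (simp add: algebra_simps)
    then have eq: "\<tau> = \<tau>'" using i by simp
    have "g s \<tau> j = g s' \<tau> j" using that(1) eq by simp
    then have "4 * \<tau> * (1 - \<tau>) * s = 4 * \<tau> * (1 - \<tau>) * s'" by (simp add: g_def)
    moreover have "\<tau> \<noteq> 0" "\<tau> \<noteq> 1" using that(3,4) g0 g1 by auto
    ultimately show ?thesis by simp
  qed
  \<comment> \<open>The parameters of the curves that hit \<open>A\<close>; each \<open>a\<close>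
    differs from both endpoints and so accounts for at most one of them.\<close>
  define Bad where "Bad = (\<Union>a\<in>A. {s \<in> {0..1}. a \<in> g s ` {0..1}})"
  have "countable {s \<in> {0..1}. a \<in> g s ` {0..1}}" if "a \<in> A" for a
  proof (cases "\<exists>s0. s0 \<in> {s \<in> {0..1}. a \<in> g s ` {0..1}}")
    case True
    then obtain s0 t0 where s0: "a = g s0 t0" "t0 \<in> {0..1}" by auto
    have "a \<noteq> x" "a \<noteq> b" using that assms by auto
    then have "{s \<in> {0..1}. a \<in> g s ` {0..1}} \<subseteq> {s0}"
      using uniq[of s0 t0] s0 by auto
    then show ?thesis by (rule countable_subset) simp
  next
    case False
    then have "{s \<in> {0..1}. a \<in> g s ` {0..1}} = {}" by blast
    then show ?thesis by (metis countable_empty)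
  qed
  then have "countable Bad" unfolding Bad_def using assms(1) by (intro countable_UN) auto
  moreover have "uncountable {0..1::real}" by (simp add: uncountable_closed_interval)
  ultimately obtain s where s: "s \<in> {0..1}" "s \<notin> Bad" by (meson countable_subset subsetI)
  have "continuous_on {0..1} (\<lambda>\<tau>. g s \<tau> k)" for k
    unfolding g_def by (cases "k = j") (auto intro!: continuous_intros)
  then have "continuous_on {0..1} (g s)" by (rule continuous_on_coordinatewise_then_product)
  then have "connected (g s ` {0..1})" by (rule connected_continuous_image) simp
  moreover have "g s ` {0..1} \<subseteq> hbox (\<lambda>_. 0) (\<lambda>_. 1) - A" using gY s by (auto simp: Bad_def)
  moreover have "x \<in> g s ` {0..1}" "b \<in> g s ` {0..1}"
    using g0 g1 by (force simp: image_iff)+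
  ultimately show ?thesis unfolding connected_component_def by blast
qed

section \<open>The Cantor set as the vertices of the Hilbert cube\<close>

definition binary_sequences :: "(nat \<Rightarrow> real) set" where
  "binary_sequences = {x. \<forall>i. x i = 0 \<or> x i = 1}"

lemma closed_binary_sequences: "closed binary_sequences"
proof -
  have "binary_sequences = (\<Inter>i. {x. x i = 0} \<union> {x. x i = 1})"
    by (auto simp: binary_sequences_def)
  moreover have "closed ({x::nat\<Rightarrow>real. x i = 0} \<union> {x. x i = 1})" for i
    by (intro closed_Un closed_Collect_eq continuous_intros continuous_on_product_coordinates)
  then have "closed (\<Inter>i. {x::nat\<Rightarrow>real. x i = 0} \<union> {x. x i = 1})"
    by (intro closed_INT) simp
  ultimately show ?thesis by simp
qed

lemma uncountable_binary_sequences: "uncountable binary_sequences"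
proof
  assume "countable binary_sequences"
  define f :: "nat set \<Rightarrow> nat \<Rightarrow> real" where "f = (\<lambda>S i. if i \<in> S then 1 else 0)"
  have "inj f" by (auto simp: inj_def f_def fun_eq_iff split: if_splits)
  moreover have "range f \<subseteq> binary_sequences" by (auto simp: f_def binary_sequences_def)
  ultimately have "countable (UNIV :: nat set set)"
    using \<open>countable binary_sequences\<close> by (meson countable_image_inj_on countable_subset)
  then obtain h :: "nat \<Rightarrow> nat set" where "range h = UNIV"
    by (metis UNIV_not_empty uncountable_def)
  then show False by (metis Cantors_theorem Pow_UNIV)
qed

lemma has_dimension_binary_sequences: "has_dimension (top_of_set binary_sequences) 0"
proof -
  let ?C = binary_sequences
  have "top_of_set ?C dim_le 0"
  proof (rule dimension_le.intros)
    fix V a assume V: "openin (top_of_set ?C) V" "a \<in> V"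
    then obtain W where W: "open W" "V = ?C \<inter> W" by (auto simp: openin_open)
    have "openin (product_topology (\<lambda>_. euclidean) UNIV) W"
      using W(1) by (simp add: euclidean_product_topology)
    then obtain X where X: "a \<in> PiE UNIV X" "finite {i. X i \<noteq> UNIV}" "PiE UNIV X \<subseteq> W"
      using product_topology_open_contains_basis[of "\<lambda>_. euclidean" UNIV W a] V(2) W(2) by auto
    define M where "M = {i. X i \<noteq> UNIV}"
    \<comment> \<open>Entries \<open>0\<close> and \<open>1\<close> that differ by less than
      \<open>1\<close> are equal, so \<open>Q\<close> cuts out a set that is closed as well as open
      in the Cantor set, with empty frontier.\<close>
    define Q where "Q = (\<Inter>i\<in>M. {y::nat\<Rightarrow>real. \<bar>y i - a i\<bar> < 1})"
    define U where "U = ?C \<inter> Q"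
    have aC: "a \<in> ?C" using V W by simp
    have close: "y i = a i" if "y \<in> ?C" "\<bar>y i - a i\<bar> < 1" for y i
    proof -
      have "y i = 0 \<or> y i = 1" "a i = 0 \<or> a i = 1"
        using that(1) aC by (auto simp: binary_sequences_def)
      then show ?thesis using that(2) by auto
    qed
    have "U = ?C \<inter> (\<Inter>i\<in>M. {y. y i = a i})"
      using close by (auto simp: U_def Q_def)
    moreover have "closed (\<Inter>i\<in>M. {y::nat\<Rightarrow>real. y i = a i})"
      by (intro closed_INT ballI closed_Collect_eq continuous_intros continuous_on_product_coordinates)
    ultimately have "closedin (top_of_set ?C) U" by (auto simp: closedin_closed)
    moreover have "open {y::nat\<Rightarrow>real. \<bar>y i - a i\<bar> < 1}" for i
      by (intro open_Collect_less continuous_intros continuous_on_product_coordinates)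
    then have "open Q" unfolding Q_def using X(2) by (auto simp: M_def)
    then have "openin (top_of_set ?C) U" by (auto simp: U_def openin_open)
    ultimately have "top_of_set ?C frontier_of U = {}"
      by (metis clopenin_eq_frontier_of)
    moreover have "U \<subseteq> V"
    proof
      fix y assume y: "y \<in> U"
      have "y i \<in> X i" for i
        using close[of y i] y X(1) by (cases "i \<in> M") (auto simp: U_def Q_def M_def PiE_def Pi_def)
      then show "y \<in> V" using X(3) y W(2) by (auto simp: U_def)
    qed
    moreover have "a \<in> U" using aC by (auto simp: U_def Q_def)
    ultimately show "\<exists>U. a \<in> U \<and> U \<subseteq> V \<and> openin (top_of_set ?C) U \<and>
        subtopology (top_of_set ?C) (top_of_set ?C frontier_of U) dim_le 0 - 1"
      using \<open>openin (top_of_set ?C) U\<close> by (intro exI[of _ U]) simp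
  qed simp
  moreover have "?C \<noteq> {}" using uncountable_binary_sequences by auto
  then have "\<not> top_of_set ?C dim_le - 1" by (simp add: subtopology_trivial_iff)
  ultimately show ?thesis by (simp add: has_dimension_def)
qed

lemma homeomorphic_space_copy_0:
  "top_of_set S homeomorphic_space top_of_set (copy_point B 0 ` S)"
proof -
  have "homeomorphic_maps (top_of_set S) (top_of_set (copy_point B 0 ` S)) (copy_point B 0)
      (\<lambda>x i. x (Suc i))"
    by (auto simp: homeomorphic_maps_def continuous_on_copy_point_snd continuous_on_shift)
  then show ?thesis by (auto simp: homeomorphic_space_def)
qed

lemma has_dimension_homeomorphic:
  "X homeomorphic_space Y \<Longrightarrow> has_dimension X n \<longleftrightarrow> has_dimension Y n"
  by (simp add: has_dimension_def homeomorphic_space_dimension_le)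

lemma vimage_copy_subset:
  assumes "A \<subseteq> copies B heights Y"
  shows "copy_point B 0 -` A \<subseteq> Y"
proof
  fix y assume "y \<in> copy_point B 0 -` A"
  then obtain s z where "z \<in> Y" "copy_point B 0 y = copy_point B s z"
    using assms by (auto simp: copies_def)
  then show "y \<in> Y" using shift_copy_point by metis
qed

lemma inj_copy_point: "inj (copy_point B t)"
  by (metis injI shift_copy_point)

section \<open>The three gaps\<close>

theorem dimensional_closed_set_aposyndetic_gap:
  fixes n :: nat
  obtains X :: "hilbert_point topology" where "continuum X"
    "dimensional_closed_set_aposyndetic n X" "\<not> dimensional_closed_set_aposyndetic (n + 1) X"
proof -
  \<comment> \<open>This is the \<open>(n + 2)\<close>-cube; the argument \<open>n + 1\<close> is
    the dimension of its boundary.\<close>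
  define Y where "Y = cube (n + 1)"
  define B where "B = cube_boundary (n + 1)"
  have Y: "compact Y" "connected Y" "locally (\<lambda>K. compact K \<and> connected K) Y"
    by (simp_all add: Y_def cube_def compact_hbox connected_hbox locally_hbox)
  have "(\<lambda>_. 0) \<in> Y" "(\<lambda>_. 0) \<notin> B" "(\<lambda>i. if i = 0 then 1 else 0) \<in> B"
    by (auto simp: Y_def B_def cube_boundary_def cube_iff)
  then have "B \<noteq> {}" "B \<noteq> Y" by auto
  moreover have "closed B" "B \<subseteq> Y"
    using closed_cube_boundary by (auto simp: B_def Y_def cube_boundary_def)
  ultimately have B: "closed B" "B \<subseteq> Y" "B \<noteq> {}" "B \<noteq> Y" by blast+
  define X where "X = copies B heights Y"
  have sub: "subtopology (top_of_set X) A = top_of_set A" if "A \<subseteq> X" for A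
    using that by (simp add: subtopology_subtopology Int_absorb1)
  have "dimensional_closed_set_aposyndetic n (top_of_set X)"
    unfolding dimensional_closed_set_aposyndetic_def X_def
  proof (rule closed_set_aposyndetic_copies[OF Y(1,3) B(1-3)])
    fix A y
    assume A: "A \<in> {A. has_dimension (subtopology (top_of_set (copies B heights Y)) A) n}" "closed A"
        "A \<subseteq> copies B heights Y" "copy_point B 0 y \<notin> A" and y: "y \<in> Y"
    \<comment> \<open>\<open>A\<close> may spread over many copies, but only its trace on the limit
      copy can block the way to \<open>B\<close>, and the upper bound on the dimension passes to
      that trace.\<close>
    define A0 where "A0 = copy_point B 0 -` A"
    have A0: "A0 \<subseteq> Y" unfolding A0_def using A(3) by (rule vimage_copy_subset)
    have clA0: "closed A0" unfolding A0_def using A(2)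
      by (intro closed_vimage continuous_on_copy_point_snd)
    then have "compact A0" using A0 Y(1) by (metis closed_Int_compact inf.absorb_iff1)
    have "top_of_set A dim_le int n" using A(1,3) sub by (simp add: has_dimension_def X_def)
    then have "top_of_set (copy_point B 0 ` A0) dim_le int n"
      by (rule dimension_le_subtopologies) (auto simp: A0_def)
    then have "top_of_set A0 dim_le int (n + 1) - 1"
      using homeomorphic_space_dimension_le[OF homeomorphic_space_copy_0[of A0 B]] by simp
    with \<open>compact A0\<close> have "nonvanishing_extension A0 (n + 1)"
      by (rule dimension_le_imp_nonvanishing_extension)
    then show "\<exists>b\<in>B. connected_component (Y - copy_point B 0 -` A) y b"
      using component_meets_cube_boundary[OF clA0 _ _ y[unfolded Y_def]] A0 A(4)
      by (auto simp: Y_def B_def A0_def)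
  qed
  moreover have "\<not> dimensional_closed_set_aposyndetic (n + 1) (top_of_set X)"
    unfolding dimensional_closed_set_aposyndetic_def X_def
  proof (rule not_closed_set_aposyndetic_copies[OF B _ Y(1)])
    have "copy_point B 0 ` B \<subseteq> X" using B(2) zero_in_heights by (auto simp: X_def copies_def)
    moreover have "has_dimension (top_of_set (copy_point B 0 ` B)) (n + 1)"
      using has_dimension_cube_boundary has_dimension_homeomorphic[OF homeomorphic_space_copy_0]
      by (metis B_def)
    ultimately show "copy_point B 0 ` B \<in>
        {A. has_dimension (subtopology (top_of_set (copies B heights Y)) A) (n + 1)}"
      using sub by (simp add: X_def)
  qed
  moreover have "continuum (top_of_set X)"
    unfolding X_def using Y(1,2) B(2,3) by (rule continuum_copies)
  ultimately show ?thesis using that by blast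
qed

text \<open>Since countable sets do not separate the Hilbert cube, any single point of
  \<open>B\<close> left free by the trace of \<open>A\<close> on the limit copy can be
  reached.\<close>

lemma closed_set_aposyndetic_copies_hilbert_cube:
  assumes "closed B" "B \<subseteq> hbox (\<lambda>_. 0) (\<lambda>_. 1)" "B \<noteq> {}"
    and "\<And>A. A \<in> \<F> \<Longrightarrow> countable A" "\<And>A. A \<in> \<F> \<Longrightarrow> \<not> B \<subseteq> copy_point B 0 -` A"
  shows "closed_set_aposyndetic (top_of_set (copies B heights (hbox (\<lambda>_. 0) (\<lambda>_. 1)))) \<F>"
proof (rule closed_set_aposyndetic_copies[OF compact_hbox locally_hbox assms(1-3)])
  fix A y
  assume A: "A \<in> \<F>" "y \<in> hbox (\<lambda>_. 0) (\<lambda>_. 1)" "copy_point B 0 y \<notin> A"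
  obtain b where b: "b \<in> B" "b \<notin> copy_point B 0 -` A" using assms(5)[OF A(1)] by blast
  have "countable (copy_point B 0 -` A)"
    using assms(4)[OF A(1)] inj_copy_point countable_image_inj_on[of "copy_point B 0"]
    by (metis countable_subset image_vimage_subset inj_on_subset subset_UNIV)
  then show "\<exists>b\<in>B. connected_component (hbox (\<lambda>_. 0) (\<lambda>_. 1) - copy_point B 0 -` A) y b"
    using A b assms(2) by (intro bexI[OF connected_component_hbox_minus_countable b(1)]) auto
qed

theorem countable_closed_set_aposyndetic_gap:
  obtains X :: "hilbert_point topology" where "continuum X"
    "countable_closed_set_aposyndetic X" "\<not> dimensional_closed_set_aposyndetic 0 X"
proof -
  define Y where "Y = hbox (\<lambda>_. 0) (\<lambda>_. 1)"
  define B where "B = binary_sequences"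
  have unc: "uncountable B" by (simp add: B_def uncountable_binary_sequences)
  have "(\<lambda>_. 1/2) \<in> Y - B" by (auto simp: Y_def B_def hbox_def binary_sequences_def)
  moreover have "B \<subseteq> Y"
  proof
    fix x assume "x \<in> B"
    then have "x i = 0 \<or> x i = 1" for i by (simp add: B_def binary_sequences_def)
    then have "0 \<le> x i \<and> x i \<le> 1" for i by (metis order_refl zero_le_one)
    then show "x \<in> Y" by (simp add: Y_def hbox_def)
  qed
  ultimately have B: "closed B" "B \<subseteq> Y" "B \<noteq> {}" "B \<noteq> Y"
    using closed_binary_sequences unc by (auto simp: B_def)
  define X where "X = copies B heights Y"
  have "countable_closed_set_aposyndetic (top_of_set X)"
    unfolding countable_closed_set_aposyndetic_def X_def Y_def
  proof (rule closed_set_aposyndetic_copies_hilbert_cube[OF B(1) _ B(3)])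
    show "B \<subseteq> hbox (\<lambda>_. 0) (\<lambda>_. 1)" using B(2) by (simp add: Y_def)
    show "\<not> B \<subseteq> copy_point B 0 -` A" if "A \<in> {A. countable A}" for A
    proof
      assume "B \<subseteq> copy_point B 0 -` A"
      then have "countable (copy_point B 0 ` B)"
        using that by (metis countable_subset image_subset_iff_subset_vimage mem_Collect_eq)
      then show False using unc inj_copy_point
        by (metis countable_image_inj_on inj_on_subset subset_UNIV)
    qed
  qed simp
  moreover have "\<not> dimensional_closed_set_aposyndetic 0 (top_of_set X)"
    unfolding dimensional_closed_set_aposyndetic_def X_def
  proof (rule not_closed_set_aposyndetic_copies[OF B])
    have "copy_point B 0 ` B \<subseteq> X" using B(2) zero_in_heights by (auto simp: X_def copies_def)
    moreover have "has_dimension (top_of_set (copy_point B 0 ` B)) 0"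
      using has_dimension_binary_sequences has_dimension_homeomorphic[OF homeomorphic_space_copy_0]
      by (metis B_def)
    ultimately show "copy_point B 0 ` B \<in>
        {A. has_dimension (subtopology (top_of_set (copies B heights Y)) A) 0}"
      by (simp add: X_def subtopology_subtopology Int_absorb1)
    show "compact Y" by (simp add: Y_def compact_hbox)
  qed
  moreover have "continuum (top_of_set X)"
    unfolding X_def using B(2,3) by (intro continuum_copies) (simp_all add: Y_def compact_hbox connected_hbox)
  ultimately show ?thesis using that by blast
qed

theorem n_aposyndetic_gap:
  fixes n :: nat
  obtains X :: "hilbert_point topology" where "continuum X"
    "n_aposyndetic n X" "\<not> n_aposyndetic (n + 1) X"
proof -
  define Y where "Y = hbox (\<lambda>_. 0) (\<lambda>_. 1)"
  define p :: "nat \<Rightarrow> nat \<Rightarrow> real" where "p = (\<lambda>k _. inverse (real (Suc k)))"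
  \<comment> \<open>\<open>{..n}\<close> has \<open>n + 1\<close> elements, so an
    \<open>n\<close>-point set always leaves a point of \<open>B\<close> free.\<close>
  define B where "B = p ` {..n}"
  have "inj p" by (auto simp: inj_def p_def fun_eq_iff)
  then have card: "finite B" "card B = n + 1"
    by (simp_all add: B_def card_image inj_on_subset)
  have "(\<lambda>_. 0) \<in> Y - B" by (auto simp: Y_def B_def hbox_def p_def fun_eq_iff)
  moreover have "B \<subseteq> Y" by (auto simp: Y_def B_def hbox_def p_def inverse_le_1_iff)
  ultimately have B: "closed B" "B \<subseteq> Y" "B \<noteq> {}" "B \<noteq> Y"
    using card by (auto simp: finite_imp_closed)
  have inj: "inj_on (copy_point B 0) S" for S by (metis inj_copy_point inj_on_subset subset_UNIV)
  define X where "X = copies B heights Y"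
  have "n_aposyndetic n (top_of_set X)"
    unfolding n_aposyndetic_def X_def Y_def
  proof (rule closed_set_aposyndetic_copies_hilbert_cube[OF B(1) _ B(3)])
    show "B \<subseteq> hbox (\<lambda>_. 0) (\<lambda>_. 1)" using B(2) by (simp add: Y_def)
    show "\<not> B \<subseteq> copy_point B 0 -` A" if A: "A \<in> {A. finite A \<and> card A = n}" for A
    proof
      assume "B \<subseteq> copy_point B 0 -` A"
      then have "card (copy_point B 0 ` B) \<le> card A"
        using A by (intro card_mono) auto
      then show False using A card by (simp add: card_image[OF inj])
    qed
  qed (auto intro: countable_finite)
  moreover have "\<not> n_aposyndetic (n + 1) (top_of_set X)"
    unfolding n_aposyndetic_def X_def
  proof (rule not_closed_set_aposyndetic_copies[OF B])
    show "copy_point B 0 ` B \<in> {A. finite A \<and> card A = n + 1}"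
      using card by (simp add: card_image[OF inj])
    show "compact Y" by (simp add: Y_def compact_hbox)
  qed
  moreover have "continuum (top_of_set X)"
    unfolding X_def using B(2,3) by (intro continuum_copies) (simp_all add: Y_def compact_hbox connected_hbox)
  ultimately show ?thesis using that by blast
qed

theorem mainTheorem4:
  shows "(\<forall>n::nat. n \<ge> 1 \<longrightarrow>
            (\<exists>X :: hilbert_point topology. continuum X \<and>
               dimensional_closed_set_aposyndetic n X \<and>
               \<not> dimensional_closed_set_aposyndetic (n + 1) X)) \<and>
         (\<exists>X :: hilbert_point topology. continuum X \<and>
            countable_closed_set_aposyndetic X \<and>
            \<not> dimensional_closed_set_aposyndetic 0 X) \<and>
         (\<forall>n::nat. n \<ge> 1 \<longrightarrow>
            (\<exists>X :: hilbert_point topology. continuum X \<and>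
               n_aposyndetic n X \<and>
               \<not> n_aposyndetic (n + 1) X))"
proof (intro conjI allI impI)
  fix n :: nat
  show "\<exists>X :: hilbert_point topology. continuum X \<and> dimensional_closed_set_aposyndetic n X \<and>
      \<not> dimensional_closed_set_aposyndetic (n + 1) X"
    by (rule dimensional_closed_set_aposyndetic_gap) blast
  show "\<exists>X :: hilbert_point topology. continuum X \<and> n_aposyndetic n X \<and> \<not> n_aposyndetic (n + 1) X"
    by (rule n_aposyndetic_gap) blast
next
  show "\<exists>X :: hilbert_point topology. continuum X \<and> countable_closed_set_aposyndetic X \<and>
      \<not> dimensional_closed_set_aposyndetic 0 X"
    by (rule countable_closed_set_aposyndetic_gap) blast
qed

end
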